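(* Let $Q$ be a quiver of type $\mathbb{A}_n$ with an arbitrary orientation. Then $$C(\mathbb{A}_n)=P(Q),\qquad C^{\mathrm{clus}}(\mathbb{A}_n)=P^{\mathrm{clus}}(Q),\qquad C^+(\mathbb{A}_n)=P^+(Q).$$ In particular, $P(Q)$, $P^{\mathrm{clus}}(Q)$ and $P^+(Q)$ are convex and do not depend on the orientation of $Q$.
   Context: Let $k$ be a field and $n\ge 1$. A quiver $Q$ of type $\mathbb{A}_n$ has vertex set $Q_0=\{1,\dots,n\}$ and exactly one arrow between $i$ and $i+1$ for each $1\le i<n$, each arrow oriented arbitrarily. Modules are finite-dimensional representations of $Q$ over $k$, considered up to isomorphism; the dimension vector of $V$ is $\underline{\dim}\,V=(\dim V_1,\dots,\dim V_n)\in\mathbb{Z}^n$, and the support of $V$ is $\{i: V_i\neq 0\}$. For $I\subseteq Q_0$, $Q|_I$ denotes the full subquiver on $I$; its modules are identified with modules over $Q$ with support in $I$. A tilting module over $Q|_I$ is a module $T$ that is a direct sum of exactly $|I|$ pairwise non-isomorphic indecomposable modules with support in $I$ and satisfies $\mathrm{Ext}^1(T,T)=0$ (for $I=\emptyset$ the zero module). $\mathcal{T}^+(Q)$ is the set of tilting modules over $Q=Q|_{Q_0}$; $\mathcal{T}^{\mathrm{clus}}(Q)$ is the set of support tilting modules, i.e. modules $T$ that are tilting modules over $Q|_{\mathrm{supp}\,T}$; $\mathcal{T}(Q)$ is the set of $2$-support tilting modules, i.e. pairs $(T^+,T^-)$ with $T^+$ tilting over $Q|_I$ and $T^-$ tilting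 over $Q|_{Q_0\setminus I}$ for some $I\subseteq Q_0$. For a tilting module $T$ let $\sigma_T=\mathrm{conv}(\{0\}\cup\{\underline{\dim}\,X : X \text{ an indecomposable summand of } T\})$. For a support tilting module $T$ with support $I$ let $\sigma_T=\mathrm{conv}(\{0\}\cup\{\underline{\dim}\,X: X \text{ indecomposable summand of } T\}\cup\{-e_j: j\in Q_0\setminus I\})$. For a $2$-support tilting module $T=(T^+,T^-)$ let $\sigma_T=\mathrm{conv}(\{0\}\cup\{\underline{\dim}\,X: X\text{ indecomposable summand of }T^+\}\cup\{-\underline{\dim}\,Y: Y\text{ indecomposable summand of }T^-\})$. Define $P^+(Q)=\bigcup_{T\in\mathcal{T}^+(Q)}\sigma_T$, $P^{\mathrm{clus}}(Q)=\bigcup_{T\in\mathcal{T}^{\mathrm{clus}}(Q)}\sigma_T$, $P(Q)=\bigcup_{T\in\mathcal{T}(Q)}\sigma_T$. Let $\Phi^+=\{e_i+e_{i+1}+\dots+e_j: 1\le i\le j\le n\}\subset\mathbb{Z}^n$ (the positive roots of $\mathbb{A}_n$ in the basis of simple roots $e_1,\dots,e_n$). Define $C^+(\mathbb{A}_n)=\mathrm{conv}(\{0\}\cup\Phi^+)$, $C^{\mathrm{clus}}(\mathbb{A}_n)=\mathrm{conv}(\Phi^+\cup\{-e_1,\dots,-e_n\})$, $C(\mathbb{A}_n)=\mathrm{conv}(\Phi^+\cup(-\Phi^+))$. *)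

theory Defs
  imports "Jordan_Normal_Form.Matrix"
begin

text \<open>Vertices are 1..n. For 1 <= a < n there is exactly one arrow, also indexed by a,
  between a and a+1; ori a = True means a -> a+1, ori a = False means a+1 -> a.\<close>

definition src :: "(nat \<Rightarrow> bool) \<Rightarrow> nat \<Rightarrow> nat" where
  "src ori a = (if ori a then a else a + 1)"

definition tgt :: "(nat \<Rightarrow> bool) \<Rightarrow> nat \<Rightarrow> nat" where
  "tgt ori a = (if ori a then a + 1 else a)"

text \<open>A representation V: at vertex i the space k^(rdim V i); at arrow a the linear map
  V_(src a) -> V_(tgt a) given by the matrix rmap V a.\<close>

record 'k rep =
  rdim :: "nat \<Rightarrow> nat"
  rmap :: "nat \<Rightarrow> 'k mat"

definition is_rep :: "nat \<Rightarrow> (nat \<Rightarrow> bool) \<Rightarrow> 'k rep \<Rightarrow> bool" where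
  "is_rep n ori V \<longleftrightarrow>
     (\<forall>i. i \<notin> {1..n} \<longrightarrow> rdim V i = 0) \<and>
     (\<forall>a\<in>{1..<n}. rmap V a \<in> carrier_mat (rdim V (tgt ori a)) (rdim V (src ori a)))"

definition rep_iso :: "nat \<Rightarrow> (nat \<Rightarrow> bool) \<Rightarrow> 'k::field rep \<Rightarrow> 'k rep \<Rightarrow> bool" where
  "rep_iso n ori V W \<longleftrightarrow>
     (\<exists>g. (\<forall>i\<in>{1..n}. g i \<in> carrier_mat (rdim W i) (rdim V i) \<and> invertible_mat (g i)) \<and>
          (\<forall>a\<in>{1..<n}. g (tgt ori a) * rmap V a = rmap W a * g (src ori a)))"

definition rep_dsum :: "(nat \<Rightarrow> bool) \<Rightarrow> 'k::field rep \<Rightarrow> 'k rep \<Rightarrow> 'k rep" where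
  "rep_dsum ori V W =
     \<lparr> rdim = (\<lambda>i. rdim V i + rdim W i),
       rmap = (\<lambda>a. four_block_mat
                 (rmap V a) (0\<^sub>m (rdim V (tgt ori a)) (rdim W (src ori a)))
                 (0\<^sub>m (rdim W (tgt ori a)) (rdim V (src ori a))) (rmap W a)) \<rparr>"

definition zero_rep :: "'k::field rep" where
  "zero_rep = \<lparr> rdim = (\<lambda>i. 0), rmap = (\<lambda>a. 0\<^sub>m 0 0) \<rparr>"

definition rep_dsum_list :: "(nat \<Rightarrow> bool) \<Rightarrow> 'k::field rep list \<Rightarrow> 'k rep" where
  "rep_dsum_list ori Xs = foldr (rep_dsum ori) Xs zero_rep"

definition rep_nonzero :: "'k rep \<Rightarrow> bool" where
  "rep_nonzero V \<longleftrightarrow> (\<exists>i. rdim V i \<noteq> 0)"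

definition supp :: "'k rep \<Rightarrow> nat set" where
  "supp V = {i. rdim V i \<noteq> 0}"

definition indecomposable :: "nat \<Rightarrow> (nat \<Rightarrow> bool) \<Rightarrow> 'k::field rep \<Rightarrow> bool" where
  "indecomposable n ori X \<longleftrightarrow> is_rep n ori X \<and> rep_nonzero X \<and>
     \<not> (\<exists>V W. is_rep n ori V \<and> is_rep n ori W \<and> rep_nonzero V \<and> rep_nonzero W \<and>
              rep_iso n ori X (rep_dsum ori V W))"

text \<open>Ext^1(M,N) = 0, via the standard (Ringel) description of Ext^1 over a path algebra:
  Ext^1(M,N) is the cokernel of
  delta : (+)_i Hom(M_i,N_i) -> (+)_a Hom(M_(src a), N_(tgt a)),
  (f_i) |-> (f_(tgt a) M_a - N_a f_(src a)).
  Equivalently: every extension 0 -> N -> E -> M -> 0 (E_a = [[N_a, h_a],[0, M_a]]) splits.\<close>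

definition ext1_zero :: "nat \<Rightarrow> (nat \<Rightarrow> bool) \<Rightarrow> 'k::field rep \<Rightarrow> 'k rep \<Rightarrow> bool" where
  "ext1_zero n ori M N \<longleftrightarrow>
     (\<forall>h. (\<forall>a\<in>{1..<n}. h a \<in> carrier_mat (rdim N (tgt ori a)) (rdim M (src ori a))) \<longrightarrow>
        (\<exists>f. (\<forall>i\<in>{1..n}. f i \<in> carrier_mat (rdim N i) (rdim M i)) \<and>
             (\<forall>a\<in>{1..<n}. h a = f (tgt ori a) * rmap M a - rmap N a * f (src ori a))))"

text \<open>A tilting module over Q|_I is given (up to isomorphism) by its list of indecomposable
  direct summands Xs: T = X_1 (+) ... (+) X_m with m = |I|, the X_j pairwise non-isomorphic
  indecomposables supported in I, and Ext^1(T,T) = 0.\<close>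

definition tilting_list :: "nat \<Rightarrow> (nat \<Rightarrow> bool) \<Rightarrow> nat set \<Rightarrow> 'k::field rep list \<Rightarrow> bool" where
  "tilting_list n ori I Xs \<longleftrightarrow>
     length Xs = card I \<and>
     (\<forall>X\<in>set Xs. indecomposable n ori X \<and> supp X \<subseteq> I) \<and>
     (\<forall>j<length Xs. \<forall>l<length Xs. j \<noteq> l \<longrightarrow> \<not> rep_iso n ori (Xs ! j) (Xs ! l)) \<and>
     ext1_zero n ori (rep_dsum_list ori Xs) (rep_dsum_list ori Xs)"

text \<open>Points of R^n are functions nat => real (coordinates 1..n; all points used vanish
  outside {1..n}).\<close>

definition dimvec :: "'k rep \<Rightarrow> nat \<Rightarrow> real" where
  "dimvec V = (\<lambda>i. real (rdim V i))"

definition unitvec :: "nat \<Rightarrow> nat \<Rightarrow> real" where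
  "unitvec j = (\<lambda>i. if i = j then 1 else 0)"

definition zerovec :: "nat \<Rightarrow> real" where
  "zerovec = (\<lambda>i. 0)"

definition negvec :: "(nat \<Rightarrow> real) \<Rightarrow> nat \<Rightarrow> real" where
  "negvec x = (\<lambda>i. - x i)"

definition conv :: "(nat \<Rightarrow> real) set \<Rightarrow> (nat \<Rightarrow> real) set" where
  "conv S = {x. \<exists>F c. finite F \<and> F \<subseteq> S \<and> F \<noteq> {} \<and> (\<forall>y\<in>F. 0 \<le> c y) \<and> sum c F = 1 \<and>
                   x = (\<lambda>i. \<Sum>y\<in>F. c y * y i)}"

definition convex_set :: "(nat \<Rightarrow> real) set \<Rightarrow> bool" where
  "convex_set S \<longleftrightarrow> (\<forall>x\<in>S. \<forall>y\<in>S. \<forall>u::real. 0 \<le> u \<and> u \<le> 1 \<longrightarrow>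
                        (\<lambda>i. u * x i + (1 - u) * y i) \<in> S)"

definition P_plus :: "'k::field itself \<Rightarrow> nat \<Rightarrow> (nat \<Rightarrow> bool) \<Rightarrow> (nat \<Rightarrow> real) set" where
  "P_plus (k::'k itself) n ori = (\<Union>{conv ({zerovec} \<union> dimvec ` set Xs) | Xs :: 'k rep list.
                         tilting_list n ori {1..n} Xs})"

definition P_clus :: "'k::field itself \<Rightarrow> nat \<Rightarrow> (nat \<Rightarrow> bool) \<Rightarrow> (nat \<Rightarrow> real) set" where
  "P_clus (k::'k itself) n ori = (\<Union>{conv ({zerovec} \<union> dimvec ` set Xs \<union> (\<lambda>j. negvec (unitvec j)) ` ({1..n} - I))
                       | (Xs :: 'k rep list) I.
                         I = \<Union>(supp ` set Xs) \<and> tilting_list n ori I Xs})"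

definition P_full :: "'k::field itself \<Rightarrow> nat \<Rightarrow> (nat \<Rightarrow> bool) \<Rightarrow> (nat \<Rightarrow> real) set" where
  "P_full (k::'k itself) n ori = (\<Union>{conv ({zerovec} \<union> dimvec ` set Xs \<union> (\<lambda>Y. negvec (dimvec Y)) ` set Ys)
                       | (Xs :: 'k rep list) (Ys :: 'k rep list) I.
                         I \<subseteq> {1..n} \<and> tilting_list n ori I Xs \<and>
                         tilting_list n ori ({1..n} - I) Ys})"

definition pos_roots :: "nat \<Rightarrow> (nat \<Rightarrow> real) set" where
  "pos_roots n = {(\<lambda>k. if i \<le> k \<and> k \<le> j then 1 else 0) | i j. 1 \<le> i \<and> i \<le> j \<and> j \<le> n}"

definition C_plus :: "nat \<Rightarrow> (nat \<Rightarrow> real) set" where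
  "C_plus n = conv ({zerovec} \<union> pos_roots n)"

definition C_clus :: "nat \<Rightarrow> (nat \<Rightarrow> real) set" where
  "C_clus n = conv (pos_roots n \<union> (\<lambda>j. negvec (unitvec j)) ` {1..n})"

definition C_full :: "nat \<Rightarrow> (nat \<Rightarrow> real) set" where
  "C_full n = conv (pos_roots n \<union> negvec ` pos_roots n)"

end

theory Submission
  imports Defs "Jordan_Normal_Form.Determinant"
begin

text \<open>
  For the inclusion of the polytopes \<open>P\<close> in the polytopes \<open>C\<close> one needs that indecomposables
  have positive roots as dimension vectors. Let \<open>j\<close> be the last vertex of the support of \<open>V\<close>.
  The space \<open>V\<^sub>j\<close> carries a flag, built vertex by vertex from images and preimages, such that at each
  step \<open>L \<subset> H\<close> of it some \<open>i \<le> j\<close> has the property that vectors of \<open>H\<close> extend to morphisms from the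
  interval module \<open>M\<^bsub>[i,j]\<^esub>\<close> to \<open>V\<close>, and functionals vanishing on \<open>L\<close> extend to morphisms from \<open>V\<close> to
  \<open>M\<^bsub>[i,j]\<^esub>\<close>. Hence \<open>M\<^bsub>[i,j]\<^esub>\<close> splits off.

  Conversely, a point \<open>x \<ge> 0\<close> is swept from left to right, keeping the intervals that are
  still open in a deque. The arrow between \<open>m\<close> and \<open>m + 1\<close> decides at which end intervals are
  opened (if \<open>x\<close> increases) or closed (if \<open>x\<close> decreases), and this keeps all intervals Ext-orthogonal.
  Each vertex contributes one new interval, so one obtains a tilting module whose cone contains \<open>x\<close>.
  The coefficients add up to the sum of the increments of \<open>x\<close>, that is, half the total variation,
  and on \<open>C\<close> the corresponding convex function is at most \<open>1\<close>.
\<close>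

section \<open>Convex combinations\<close>

text \<open>For two overlapping intervals, a splitting has one unknown per common vertex and one
  equation per arrow from the first interval to the second. Inside the intersection there is one
  arrow fewer than vertices, so the equations can fail only if the arrows at both of its ends
  contribute. For intervals that are still open the left end of the intersection is settled; the
  arrow at \<open>m\<close> then says which of the two may be closed. Hence the linear order on the
  left ends. The cone is found before the simplex: its weights have a total that does not see the
  orientation, which only decides which intervals carry them. This is the source of the independence
  of the orientation. A point of mixed sign is split into its positive part \<open>p\<close> and its
  negative part \<open>q\<close>, with \<open>I\<close> the set where it is positive. The increments
  of \<open>p\<close> alone are not a convex function of the point. They become one after the
  weights spent on \<open>q\<close> are added, and then a bound at the generators of
  \<open>C\<close> is enough.\<close>

lemma conv_increasing: "S \<subseteq> conv S"
proof
  fix y assume "y \<in> S"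
  then show "y \<in> conv S"
    unfolding conv_def by (intro CollectI exI[of _ "{y}"] exI[of _ "\<lambda>_. 1"]) auto
qed

text \<open>\<open>conv\<close> weights the points of a set, whereas the families used later may
  repeat a point; the weights over each point are therefore added up.\<close>

lemma conv_combination:
  fixes y :: "'a \<Rightarrow> nat \<Rightarrow> real"
  assumes "finite A" "\<And>a. a \<in> A \<Longrightarrow> 0 \<le> c a" "sum c A = 1" "y ` A \<subseteq> S"
  shows "(\<lambda>i. \<Sum>a\<in>A. c a * y a i) \<in> conv S"
proof -
  define d where "d v = sum c {a \<in> A. y a = v}" for v
  have "sum d (y ` A) = 1"
    using sum.image_gen[OF assms(1), of c y] assms(3) by (simp add: d_def)
  moreover have "(\<Sum>a\<in>A. c a * y a i) = (\<Sum>v\<in>y ` A. d v * v i)" for i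
    unfolding sum.image_gen[OF assms(1), of "\<lambda>a. c a * y a i" y] d_def sum_distrib_right
    by (intro sum.cong) auto
  moreover have "A \<noteq> {}" using assms(3) by auto
  ultimately show ?thesis
    unfolding conv_def using assms
    by (intro CollectI exI[of _ "y ` A"] exI[of _ d]) (auto simp: d_def intro!: sum_nonneg)
qed

lemma convex_set_conv: "convex_set (conv S)"
  unfolding convex_set_def
proof (intro ballI allI impI)
  fix x y and u :: real
  assume "x \<in> conv S" "y \<in> conv S" and u: "0 \<le> u \<and> u \<le> 1"
  then obtain F c G d where F: "finite F" "F \<subseteq> S" "\<forall>y\<in>F. 0 \<le> c y" "sum c F = 1" "x = (\<lambda>i. \<Sum>y\<in>F. c y * y i)"
    and G: "finite G" "G \<subseteq> S" "\<forall>y\<in>G. 0 \<le> d y" "sum d G = 1" "y = (\<lambda>i. \<Sum>y\<in>G. d y * y i)"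
    unfolding conv_def by blast
  \<comment> \<open>The disjoint sum keeps apart the points that \<open>F\<close> and
    \<open>G\<close> have in common.\<close>
  have "(\<lambda>i. \<Sum>a\<in>F <+> G. (case a of Inl f \<Rightarrow> u * c f | Inr g \<Rightarrow> (1 - u) * d g) * (case a of Inl f \<Rightarrow> f | Inr g \<Rightarrow> g) i) \<in> conv S"
    using u F G by (intro conv_combination) (auto simp: sum.Plus simp flip: sum_distrib_left)
  then show "(\<lambda>i. u * x i + (1 - u) * y i) \<in> conv S"
    using F(1) G(1) by (simp add: F(5) G(5) sum.Plus sum_distrib_left mult.assoc)
qed

lemma convex_set_combination:
  assumes "convex_set K" "finite A" "\<And>a. a \<in> A \<Longrightarrow> 0 \<le> c a" "sum c A = 1" "y ` A \<subseteq> K"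
  shows "(\<lambda>i. \<Sum>a\<in>A. c a * y a i) \<in> K"
  using assms(2-)
proof (induction A arbitrary: c rule: finite_induct)
  case (insert a A)
  have nn: "0 \<le> sum c A" using insert.prems by (intro sum_nonneg) auto
  have s: "c a + sum c A = 1" using insert by simp
  show ?case
  \<comment> \<open>The induction hypothesis needs the remaining weights rescaled to total 1, which
    is impossible if all of them vanish.\<close>
  proof (cases "sum c A = 0")
    case True
    then have "c b = 0" if "b \<in> A" for b
      using that insert.hyps insert.prems(1) sum_nonneg_eq_0_iff[of A c] by auto
    then show ?thesis using insert s True by simp
  next
    case False
    let ?z = "\<lambda>i. \<Sum>b\<in>A. (c b / sum c A) * y b i"
    have "?z \<in> K"
      using insert.prems nn False by (intro insert.IH) (auto simp flip: sum_divide_distrib)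
    then have "(\<lambda>i. c a * y a i + (1 - c a) * ?z i) \<in> K"
      using assms(1) insert.prems nn s unfolding convex_set_def by auto
    moreover have "(1 - c a) * ?z i = (\<Sum>b\<in>A. c b * y b i)" for i
    proof -
      have "1 - c a = sum c A" using s by simp
      then show ?thesis using False by (simp add: sum_distrib_left)
    qed
    ultimately show ?thesis using insert.hyps by simp
  qed
qed simp

lemma conv_minimal:
  assumes "convex_set K" "S \<subseteq> K"
  shows "conv S \<subseteq> K"
proof
  fix x assume "x \<in> conv S"
  then obtain F c where "finite F" "F \<subseteq> S" "\<forall>y\<in>F. 0 \<le> c y" "sum c F = 1" "x = (\<lambda>i. \<Sum>y\<in>F. c y * y i)"
    unfolding conv_def by blast
  then show "x \<in> K"
    using convex_set_combination[OF assms(1), of F c "\<lambda>y. y"] assms(2) by auto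
qed

text \<open>The vertex 0 of the simplex, entered under the extra index \<open>?m\<close>, absorbs
  the missing weight. So membership in a simplex reduces to one inequality for the total.\<close>

lemma conv_list_combination:
  assumes "zerovec \<in> S" "\<And>t. t \<in> set ts \<Longrightarrow> 0 \<le> c t \<and> y t \<in> S" "(\<Sum>t\<leftarrow>ts. c t) \<le> 1"
  shows "(\<lambda>i. \<Sum>t\<leftarrow>ts. c t * y t i) \<in> conv S"
proof -
  let ?m = "length ts"
  let ?c = "\<lambda>k. if k < ?m then c (ts ! k) else 1 - (\<Sum>t\<leftarrow>ts. c t)"
  let ?y = "\<lambda>k. if k < ?m then y (ts ! k) else zerovec"
  have "(\<lambda>i. \<Sum>k<Suc ?m. ?c k * ?y k i) \<in> conv S"
    using assms by (intro conv_combination) (auto simp: sum_list_sum_nth atLeast0LessThan)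
  then show ?thesis
    by (simp add: sum_list_sum_nth atLeast0LessThan zerovec_def)
qed

section \<open>Decomposing a nonnegative vector into Ext-orthogonal intervals\<close>

text \<open>A sufficient condition for \<open>Ext\<^sup>1(M\<^sub>A, M\<^sub>B) = 0\<close> for thin modules: then the equations for a
  splitting can be solved recursively, from right to left or from left to right.\<close>

definition ext_free :: "(nat \<Rightarrow> bool) \<Rightarrow> nat set \<Rightarrow> nat set \<Rightarrow> bool" where
  "ext_free ori A B \<longleftrightarrow>
     (\<forall>a. src ori a \<in> A \<and> tgt ori a \<in> B \<longrightarrow> a \<in> A \<inter> B) \<or>
     (\<forall>a. src ori a \<in> A \<and> tgt ori a \<in> B \<longrightarrow> Suc a \<in> A \<inter> B)"

text \<open>The order of the deque: \<open>above ori i k\<close> means that, of two open intervals with left ends \<open>i\<close>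
  and \<open>k\<close>, the former is nearer to the top.\<close>

definition above :: "(nat \<Rightarrow> bool) \<Rightarrow> nat \<Rightarrow> nat \<Rightarrow> bool" where
  "above ori i k \<longleftrightarrow> (k < i \<and> ori (i - 1)) \<or> (i < k \<and> \<not> ori (k - 1))"

text \<open>Every arrow involved has \<open>Suc a\<close> at or beyond both left ends and not beyond
  the common right end, so the equations are solved from left to right.\<close>

lemma ext_free_same_end: "ext_free ori {i..m} {k..m}"
  unfolding ext_free_def src_def tgt_def by (auto split: if_splits)

text \<open>Because of \<open>l < m\<close> no arrow joins the two sets, and the condition is
  vacuous.\<close>

lemma ext_free_singleton: "l < m \<Longrightarrow> ext_free ori {Suc m} {k..l}" "l < m \<Longrightarrow> ext_free ori {k..l} {Suc m}"
  unfolding ext_free_def src_def tgt_def by (auto split: if_splits)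

text \<open>The only added vertex \<open>Suc m\<close> has all its neighbours beyond
  \<open>l\<close>, so neither the arrows between the intervals nor their intersection
  change.\<close>

lemma ext_free_extend:
  assumes "l < m" "i \<le> m"
  shows "ext_free ori {i..m} {k..l} \<Longrightarrow> ext_free ori {i..Suc m} {k..l}"
    and "ext_free ori {k..l} {i..m} \<Longrightarrow> ext_free ori {k..l} {i..Suc m}"
proof -
  have *: "src ori a \<in> {i..Suc m} \<and> tgt ori a \<in> {k..l} \<longleftrightarrow> src ori a \<in> {i..m} \<and> tgt ori a \<in> {k..l}"
       "src ori a \<in> {k..l} \<and> tgt ori a \<in> {i..Suc m} \<longleftrightarrow> src ori a \<in> {k..l} \<and> tgt ori a \<in> {i..m}" for a
    using assms by (auto simp: src_def tgt_def)
  have **: "{i..Suc m} \<inter> {k..l} = {i..m} \<inter> {k..l}" "{k..l} \<inter> {i..Suc m} = {k..l} \<inter> {i..m}" using assms by auto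
  show "ext_free ori {i..m} {k..l} \<Longrightarrow> ext_free ori {i..Suc m} {k..l}"
       "ext_free ori {k..l} {i..m} \<Longrightarrow> ext_free ori {k..l} {i..Suc m}"
    unfolding ext_free_def * ** by auto
qed

text \<open>The arrow at \<open>m\<close> contributes an equation to only one of the two directions.
  In that direction, \<open>above\<close> says precisely that the arrow at the left end of the
  intersection contributes none, so solving from right to left works. The other direction is solved
  from left to right.\<close>

lemma ext_free_pop:
  assumes "1 \<le> p" "1 \<le> q" "p \<le> m" "q \<le> m" "p = q \<or> (if ori m then above ori p q else above ori q p)"
  shows "ext_free ori {p..m} {q..Suc m}" "ext_free ori {q..Suc m} {p..m}"
proof -
  have "ext_free ori {p..m} {q..Suc m} \<and> ext_free ori {q..Suc m} {p..m}"
  proof (cases "ori m")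
    case True
    have "ext_free ori {p..m} {q..Suc m}"
      unfolding ext_free_def
    proof (rule disjI1, intro allI impI)
      fix a assume "src ori a \<in> {p..m} \<and> tgt ori a \<in> {q..Suc m}"
      then show "a \<in> {p..m} \<inter> {q..Suc m}"
        using assms True unfolding src_def tgt_def above_def
        by (cases "Suc a = q"; cases "Suc a = p") (auto split: if_splits)
    qed
    moreover have "ext_free ori {q..Suc m} {p..m}"
      unfolding ext_free_def
    proof (rule disjI2, intro allI impI)
      fix a assume "src ori a \<in> {q..Suc m} \<and> tgt ori a \<in> {p..m}"
      then show "Suc a \<in> {q..Suc m} \<inter> {p..m}"
        using assms True unfolding src_def tgt_def above_def
        by (cases "a = m") (auto split: if_splits)
    qed
    ultimately show ?thesis by simp
  next
    case False
    have "ext_free ori {p..m} {q..Suc m}"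
      unfolding ext_free_def
    proof (rule disjI2, intro allI impI)
      fix a assume "src ori a \<in> {p..m} \<and> tgt ori a \<in> {q..Suc m}"
      then show "Suc a \<in> {p..m} \<inter> {q..Suc m}"
        using assms False unfolding src_def tgt_def above_def
        by (cases "a = m") (auto split: if_splits)
    qed
    moreover have "ext_free ori {q..Suc m} {p..m}"
      unfolding ext_free_def
    proof (rule disjI1, intro allI impI)
      fix a assume "src ori a \<in> {q..Suc m} \<and> tgt ori a \<in> {p..m}"
      then show "a \<in> {q..Suc m} \<inter> {p..m}"
        using assms False unfolding src_def tgt_def above_def
        by (cases "Suc a = q"; cases "Suc a = p") (auto split: if_splits)
    qed
    ultimately show ?thesis by simp
  qed
  then show "ext_free ori {p..m} {q..Suc m}" "ext_free ori {q..Suc m} {p..m}" by auto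
qed

section \<open>Sweeping a nonnegative vector from left to right\<close>

lemma split_weights:
  fixes d :: real
  assumes "\<And>t. t \<in> set L \<Longrightarrow> 0 \<le> snd t" "0 \<le> d" "d \<le> (\<Sum>(i, c)\<leftarrow>L. c)" "0 < (\<Sum>(i, c)\<leftarrow>L. c)"
  shows "\<exists>P s c b R. L = P @ (s, c) # R \<and> 0 \<le> b \<and> b \<le> c \<and> (\<Sum>(i, c)\<leftarrow>P. c) + b = d"
  using assms
proof (induction L arbitrary: d)
  case (Cons t L)
  obtain s c where t: "t = (s, c)" by fastforce
  show ?case
  proof (cases "d \<le> c")
    case True
    then show ?thesis using Cons.prems t by (intro exI[of _ "[]"]) auto
  next
    case False
    have "\<exists>P s' c' b R. L = P @ (s', c') # R \<and> 0 \<le> b \<and> b \<le> c' \<and> (\<Sum>(i, c)\<leftarrow>P. c) + b = d - c"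
      using Cons.prems False t by (intro Cons.IH) auto
    then obtain P s' c' b R where "L = P @ (s', c') # R" "0 \<le> b" "b \<le> c'" "(\<Sum>(i, c)\<leftarrow>P. c) + b = d - c"
      by blast
    then show ?thesis using t by (intro exI[of _ "t # P"]) auto
  qed
qed simp

text \<open>Weights may be zero: a point on a face of a cone still needs as many intervals as there
  are vertices. The last clause is the quantity that is eventually compared with 1.\<close>

definition decomposition :: "(nat \<Rightarrow> bool) \<Rightarrow> nat set \<Rightarrow> (nat \<Rightarrow> real) \<Rightarrow> nat \<Rightarrow> (nat \<times> nat \<times> real) list \<Rightarrow> bool" where
  "decomposition ori I x m T \<longleftrightarrow>
     (\<forall>(i, j, c)\<in>set T. 1 \<le> i \<and> i \<le> j \<and> j \<le> m \<and> {i..j} \<subseteq> I \<and> 0 \<le> c) \<and>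
     length T = card (I \<inter> {1..m}) \<and>
     distinct (map (\<lambda>(i, j, c). (i, j)) T) \<and>
     (\<forall>(i, j, c)\<in>set T. \<forall>(k, l, d)\<in>set T. ext_free ori {i..j} {k..l}) \<and>
     (\<forall>v\<in>{1..m}. x v = (\<Sum>(i, j, c)\<leftarrow>T. if i \<le> v \<and> v \<le> j then c else 0)) \<and>
     (\<Sum>(i, j, c)\<leftarrow>T. c) = (\<Sum>v\<in>{1..m}. max 0 (x v - x (v - 1)))"

lemma decompositionI:
  assumes "\<And>i j c. (i, j, c) \<in> set T \<Longrightarrow> 1 \<le> i \<and> i \<le> j \<and> j \<le> m \<and> {i..j} \<subseteq> I \<and> 0 \<le> c"
    and "length T = card (I \<inter> {1..m})" "distinct (map (\<lambda>(i, j, c). (i, j)) T)"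
    and "\<And>i j k l c d. (i, j, c) \<in> set T \<Longrightarrow> (k, l, d) \<in> set T \<Longrightarrow> ext_free ori {i..j} {k..l}"
    and "\<And>v. 1 \<le> v \<Longrightarrow> v \<le> m \<Longrightarrow> x v = (\<Sum>(i, j, c)\<leftarrow>T. if i \<le> v \<and> v \<le> j then c else 0)"
    and "(\<Sum>(i, j, c)\<leftarrow>T. c) = (\<Sum>v\<in>{1..m}. max 0 (x v - x (v - 1)))"
  shows "decomposition ori I x m T"
  unfolding decomposition_def using assms by auto

text \<open>The deque is used at its top if \<open>m \<rightarrow> m + 1\<close>, and at its bottom otherwise.\<close>

definition pops_before :: "(nat \<Rightarrow> bool) \<Rightarrow> nat \<Rightarrow> nat \<Rightarrow> nat \<Rightarrow> bool" where
  "pops_before ori m p q \<longleftrightarrow> (if ori m then above ori p q else above ori q p)"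

text \<open>\<open>M\<close> lists the open intervals, the next one to be closed first;
  \<open>C\<close> is closed at \<open>m\<close>, and \<open>N\<close> stays open. In both cases one
  interval is gained, either a new one carrying the increase or the second copy of an interval that
  is cut. This is the contribution of the vertex \<open>Suc m\<close>.\<close>

lemma deque_step:
  fixes M :: "(nat \<times> real) list"
  assumes M: "sorted_wrt (\<lambda>p q. pops_before ori m (fst p) (fst q)) M" "\<And>t. t \<in> set M \<Longrightarrow> 1 \<le> fst t \<and> fst t \<le> m \<and> 0 \<le> snd t"
    and x: "x m = (\<Sum>(i, c)\<leftarrow>M. c)" "0 \<le> x m" "0 \<le> x (Suc m)"
  shows "\<exists>C N. fst ` set C \<subseteq> fst ` set M \<and> fst ` set N \<subseteq> insert (Suc m) (fst ` set M) \<and>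
    length C + length N = Suc (length M) \<and> distinct (map fst C) \<and> sorted_wrt (\<lambda>p q. pops_before ori m (fst p) (fst q)) N \<and>
    (\<forall>t\<in>set C \<union> set N. 0 \<le> snd t) \<and>
    (\<forall>p\<in>set C. \<forall>q\<in>set N. fst q \<le> m \<and> (fst p = fst q \<or> pops_before ori m (fst p) (fst q))) \<and>
    (\<forall>v\<le>m. (\<Sum>(i, c)\<leftarrow>M. if i \<le> v then c else 0) =
       (\<Sum>(i, c)\<leftarrow>C. if i \<le> v then c else 0) + (\<Sum>(i, c)\<leftarrow>N. if i \<le> v then c else 0)) \<and>
    (\<Sum>(i, c)\<leftarrow>N. c) = x (Suc m) \<and>
    (\<Sum>(i, c)\<leftarrow>C. c) + (\<Sum>(i, c)\<leftarrow>N. c) = (\<Sum>(i, c)\<leftarrow>M. c) + max 0 (x (Suc m) - x m)"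
proof (cases "x m \<le> x (Suc m)")
  case True
  \<comment> \<open>Against an earlier left end, \<open>above\<close> ranks \<open>Suc m\<close> by
    \<open>ori m\<close>, so the new interval belongs exactly at the end of the deque now in
    use.\<close>
  have "pops_before ori m (Suc m) (fst q)" if "q \<in> set M" for q
    using M(2)[OF that] by (auto simp: pops_before_def above_def)
  then show ?thesis
    using True x M by (intro exI[of _ "[]"] exI[of _ "(Suc m, x (Suc m) - x m) # M"]) auto
next
  case False
  \<comment> \<open>The decrease is taken off the head of the deque. The interval starting at
    \<open>s\<close>, where the running total reaches it, is cut: weight \<open>b\<close> is closed
    and \<open>c - b\<close> stays open, even if one of them is 0.\<close>
  have "\<exists>P s c b R. M = P @ (s, c) # R \<and> 0 \<le> b \<and> b \<le> c \<and> (\<Sum>(i, c)\<leftarrow>P. c) + b = x m - x (Suc m)"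
    using False M(2) x by (intro split_weights) auto
  then obtain P s c b R where s: "M = P @ (s, c) # R" "0 \<le> b" "b \<le> c" "(\<Sum>(i, c)\<leftarrow>P. c) + b = x m - x (Suc m)"
    by blast
  \<comment> \<open>\<open>above\<close> is irreflexive, so a sorted deque has no repeated left
    end.\<close>
  have d: "distinct (map fst M)" using M(1)
    by (induction M) (auto simp: pops_before_def above_def split: if_splits)
  have max: "max 0 (x (Suc m) - x m) = 0" using False by simp
  show ?thesis
  proof (rule exI[of _ "P @ [(s, b)]"], rule exI[of _ "(s, c - b) # R"], intro conjI ballI allI impI)
    show "sorted_wrt (\<lambda>p q. pops_before ori m (fst p) (fst q)) ((s, c - b) # R)"
      using M(1) s(1) by (simp add: sorted_wrt_append)
    show "0 \<le> snd t" if "t \<in> set (P @ [(s, b)]) \<union> set ((s, c - b) # R)" for t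
      using that M(2)[of t] s by auto
    \<comment> \<open>Nothing is opened while something is closed; otherwise an interval could start
      right behind the end of another one, and the arrow between them would give an
      extension.\<close>
    show "fst q \<le> m" if "q \<in> set ((s, c - b) # R)" for q
      using that M(2)[of q] M(2)[of "(s, c)"] s by auto
    show "fst p = fst q \<or> pops_before ori m (fst p) (fst q)" if "p \<in> set (P @ [(s, b)])" "q \<in> set ((s, c - b) # R)" for p q
      using M(1) s(1) that by (auto simp: sorted_wrt_append)
    show "(\<Sum>(i, c)\<leftarrow>(s, c - b) # R. c) = x (Suc m)"
      using s x by simp
  qed (use s d max in auto)
qed

text \<open>Allows the deque to be read from either end, as no clause of
  \<open>decomposition\<close> depends on the order of the list.\<close>

lemma decomposition_rev:
  "decomposition ori I x m (K @ map f (rev L)) \<longleftrightarrow> decomposition ori I x m (K @ map f L)"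
  unfolding decomposition_def by (simp add: comp_def flip: rev_map)

text \<open>No interval reaches a vertex outside \<open>I\<close>, and \<open>x\<close> does not
  increase on entering it, so every clause persists.\<close>

lemma decomposition_skip:
  assumes T: "decomposition ori I x m T" and "Suc m \<notin> I" "0 \<le> x m" "x (Suc m) = 0"
  shows "decomposition ori I x (Suc m) T"
proof -
  have "{1..Suc m} = insert (Suc m) {1..m}" by auto
  then have I: "I \<inter> {1..Suc m} = I \<inter> {1..m}" using assms(2) by auto
  have "(\<Sum>(i, j, c)\<leftarrow>T. if i \<le> Suc m \<and> Suc m \<le> j then c else 0) = (\<Sum>t\<leftarrow>T. 0)"
    using T unfolding decomposition_def by (intro arg_cong[of _ _ sum_list] map_cong) auto
  then show ?thesis
    using T assms(3,4) unfolding decomposition_def I by (auto simp: le_Suc_eq)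
qed

text \<open>The groups \<open>K\<close>, \<open>C\<close> and \<open>N\<close> have right ends below
  \<open>m\<close>, equal to \<open>m\<close> and equal to \<open>Suc m\<close>. This separates them
  for distinctness. For Ext, pairs inside \<open>C\<close> or \<open>N\<close> share their right
  end, \<open>K\<close> is too far left to notice the new vertex, and only \<open>C\<close> against
  \<open>N\<close> needs the order of the deque.\<close>

lemma decomposition_extend:
  assumes T: "decomposition ori I x m (K @ map (\<lambda>(i, c). (i, m, c)) M)"
    and K: "\<forall>(i, j, c)\<in>set K. j < m" and m: "Suc m \<in> I"
    and C: "fst ` set C \<subseteq> fst ` set M" and N: "fst ` set N \<subseteq> insert (Suc m) (fst ` set M)"
    and len: "length C + length N = Suc (length M)"
    and dist: "distinct (map fst C)" "sorted_wrt (\<lambda>p q. pops_before ori m (fst p) (fst q)) N"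
    and nonneg: "\<forall>t\<in>set C \<union> set N. 0 \<le> snd t"
    and rel: "\<forall>p\<in>set C. \<forall>q\<in>set N. fst q \<le> m \<and> (fst p = fst q \<or> pops_before ori m (fst p) (fst q))"
    and sums: "\<forall>v\<le>m. (\<Sum>(i, c)\<leftarrow>M. if i \<le> v then c else 0) =
       (\<Sum>(i, c)\<leftarrow>C. if i \<le> v then c else 0) + (\<Sum>(i, c)\<leftarrow>N. if i \<le> v then c else 0)"
      "(\<Sum>(i, c)\<leftarrow>N. c) = x (Suc m)"
      "(\<Sum>(i, c)\<leftarrow>C. c) + (\<Sum>(i, c)\<leftarrow>N. c) = (\<Sum>(i, c)\<leftarrow>M. c) + max 0 (x (Suc m) - x m)"
  shows "decomposition ori I x (Suc m) (K @ map (\<lambda>(i, c). (i, m, c)) C @ map (\<lambda>(i, c). (i, Suc m, c)) N)"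
proof -
  let ?T = "K @ map (\<lambda>(i, c). (i, m, c)) M"
  let ?T' = "K @ map (\<lambda>(i, c). (i, m, c)) C @ map (\<lambda>(i, c). (i, Suc m, c)) N"
  have T1: "1 \<le> i \<and> i \<le> j \<and> j \<le> m \<and> {i..j} \<subseteq> I \<and> 0 \<le> c" if "(i, j, c) \<in> set ?T" for i j c
    using T that unfolding decomposition_def by blast
  have T2: "length ?T = card (I \<inter> {1..m})" using T unfolding decomposition_def by blast
  have T3: "distinct (map (\<lambda>(i, j, c). (i, j)) ?T)" using T unfolding decomposition_def by blast
  have T4: "ext_free ori {i..j} {k..l}" if "(i, j, c) \<in> set ?T" "(k, l, d) \<in> set ?T" for i j k l c d
    using T that unfolding decomposition_def by blast
  have T5: "x v = (\<Sum>(i, j, c)\<leftarrow>?T. if i \<le> v \<and> v \<le> j then c else 0)" if "1 \<le> v" "v \<le> m" for v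
    using T that unfolding decomposition_def by (meson atLeastAtMost_iff)
  have T6: "(\<Sum>(i, j, c)\<leftarrow>?T. c) = (\<Sum>v\<in>{1..m}. max 0 (x v - x (v - 1)))"
    using T unfolding decomposition_def by blast
  have KD: "1 \<le> i \<and> i \<le> j \<and> j < m \<and> {i..j} \<subseteq> I \<and> 0 \<le> c" if "(i, j, c) \<in> set K" for i j c
    using T1[of i j c] K that by auto
  have MD: "1 \<le> i \<and> i \<le> m \<and> {i..m} \<subseteq> I \<and> (\<exists>d. (i, m, d) \<in> set ?T)" if "i \<in> fst ` set M" for i
    using T1[of i m] that by force
  have CD: "1 \<le> i \<and> i \<le> m \<and> {i..m} \<subseteq> I \<and> 0 \<le> c \<and> (\<exists>d. (i, m, d) \<in> set ?T)" if "(i, c) \<in> set C" for i c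
    using C that MD[of i] nonneg by force
  have ND: "1 \<le> i \<and> i \<le> Suc m \<and> {i..Suc m} \<subseteq> I \<and> 0 \<le> c \<and> (i \<noteq> Suc m \<longrightarrow> (\<exists>d. (i, m, d) \<in> set ?T))"
    if "(i, c) \<in> set N" for i c
  proof -
    have "i = Suc m \<or> i \<in> fst ` set M" "0 \<le> c" using that N nonneg by force+
    moreover have "i = Suc m \<Longrightarrow> 1 \<le> i \<and> {i..Suc m} \<subseteq> I" using m by simp
    moreover have "{i..Suc m} \<subseteq> insert (Suc m) {i..m}" by auto
    ultimately show ?thesis using MD[of i] m by (smt (verit) insert_iff le_SucI order_refl subset_iff)
  qed
  have e1: "ext_free ori {i..j} {k..m} \<and> ext_free ori {k..m} {i..j}"
    if "(i, j, c) \<in> set K" "(k, d) \<in> set C" for i j k c d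
    using CD[OF that(2)] that(1) T4 by (metis Un_iff set_append)
  have e2: "ext_free ori {i..j} {k..Suc m} \<and> ext_free ori {k..Suc m} {i..j}"
    if "(i, j, c) \<in> set K" "(k, d) \<in> set N" for i j k c d
  proof (cases "k = Suc m")
    case True
    then show ?thesis using KD[OF that(1)] by (simp add: ext_free_singleton)
  next
    case False
    then show ?thesis using KD[OF that(1)] ND[OF that(2)] that(1) T4
      by (metis ext_free_extend Un_iff set_append le_Suc_eq)
  qed
  have e3: "ext_free ori {i..m} {k..Suc m} \<and> ext_free ori {k..Suc m} {i..m}"
    if "(i, c) \<in> set C" "(k, d) \<in> set N" for i k c d
  proof -
    have "fst (k, d) \<le> m \<and> (fst (i, c) = fst (k, d) \<or> pops_before ori m (fst (i, c)) (fst (k, d)))" using rel that by blast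
    then have "k \<le> m" "i = k \<or> (if ori m then above ori i k else above ori k i)" by (auto simp: pops_before_def split: if_splits)
    then show ?thesis
      using ext_free_pop[of i k m ori] CD[OF that(1)] ND[OF that(2)] by blast
  qed
  have distN: "distinct (map fst N)" using dist(2)
    by (induction N) (auto simp: pops_before_def above_def split: if_splits)
  have D: "distinct (map (\<lambda>(i, j, c). (i, j)) ?T')"
  proof -
    have a: "distinct (map (\<lambda>(i, j, c). (i, j)) (map (\<lambda>(i, c). (i, j, c)) Z))" if "distinct (map fst Z)"
      for j :: nat and Z :: "(nat \<times> real) list"
      using that by (induction Z) force+
    have "\<forall>t\<in>set K. fst (snd t) < m" using KD by auto
    then show ?thesis using T3 a[OF dist(1), of m] a[OF distN, of "Suc m"]
      by (auto simp: distinct_append)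
  qed
  have L: "length ?T' = card (I \<inter> {1..Suc m})"
  proof -
    have "I \<inter> {1..Suc m} = insert (Suc m) (I \<inter> {1..m})" using m by auto
    then show ?thesis using T2 len by simp
  qed
  have Z: "(\<Sum>(i, j, c)\<leftarrow>map (\<lambda>(i, c). (i, j, c)) Z. if i \<le> v \<and> v \<le> j then c else 0) =
     (if v \<le> j then (\<Sum>(i, c)\<leftarrow>Z. if i \<le> v then c else 0) else 0)" for j v and Z :: "(nat \<times> real) list"
    by (induction Z) auto
  have Z': "(\<Sum>(i, j, c)\<leftarrow>map (\<lambda>(i, c). (i, j, c)) Z. c) = (\<Sum>(i, c)\<leftarrow>Z. c)" for j :: nat and Z :: "(nat \<times> real) list"
    by (induction Z) auto
  have X: "x v = (\<Sum>(i, j, c)\<leftarrow>?T'. if i \<le> v \<and> v \<le> j then c else 0)" if "1 \<le> v" "v \<le> Suc m" for v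
  proof (cases "v \<le> m")
    case True
    then show ?thesis using T5[OF that(1) True] sums(1) by (simp only: map_append sum_list_append Z) simp
  next
    case False
    then have v: "v = Suc m" using that by simp
    have "(\<Sum>(i, j, c)\<leftarrow>K. if i \<le> v \<and> v \<le> j then c else 0) = (\<Sum>t\<leftarrow>K. 0)"
      using KD v by (intro arg_cong[of _ _ sum_list] map_cong) force+
    moreover have "(\<Sum>(i, c)\<leftarrow>N. if i \<le> v then c else 0) = (\<Sum>(i, c)\<leftarrow>N. c)"
      using ND v by (intro arg_cong[of _ _ sum_list] map_cong) auto
    ultimately show ?thesis using v sums(2) by (simp only: map_append sum_list_append Z) simp
  qed
  have W: "(\<Sum>(i, j, c)\<leftarrow>?T'. c) = (\<Sum>v\<in>{1..Suc m}. max 0 (x v - x (v - 1)))"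
    using T6 sums(3) by (simp only: map_append sum_list_append Z') simp
  have E: "ext_free ori {i..j} {k..l}" if "(i, j, c) \<in> set ?T'" "(k, l, d) \<in> set ?T'" for i j k l c d
  proof -
    have ij: "(i, j, c) \<in> set K \<or> (i, c) \<in> set C \<and> j = m \<or> (i, c) \<in> set N \<and> j = Suc m"
      using that(1) by auto
    have kl: "(k, l, d) \<in> set K \<or> (k, d) \<in> set C \<and> l = m \<or> (k, d) \<in> set N \<and> l = Suc m"
      using that(2) by auto
    have K4: "ext_free ori {i..j} {k..l}" if "(i, j, c) \<in> set K" "(k, l, d) \<in> set K"
      using T4[of i j c k l d] that by simp
    show ?thesis
      using ij kl by (elim disjE conjE; hypsubst?; use K4 e1 e2 e3 ext_free_same_end in blast)
  qed
  have B: "1 \<le> i \<and> i \<le> j \<and> j \<le> Suc m \<and> {i..j} \<subseteq> I \<and> 0 \<le> c" if "(i, j, c) \<in> set ?T'" for i j c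
    using that KD[of i j c] CD[of i c] ND[of i c] by auto
  show ?thesis
    by (rule decompositionI[where T = ?T']) (erule B, rule L, rule D, erule (1) E, erule (1) X, rule W)
qed

lemma deque_invariant:
  assumes I: "0 \<notin> I" and x: "\<And>v. 0 \<le> x v" "\<And>v. v \<notin> I \<Longrightarrow> x v = 0"
  shows "\<exists>K L. decomposition ori I x m (K @ map (\<lambda>(i, c). (i, m, c)) L) \<and>
    (\<forall>(i, j, c)\<in>set K. j < m) \<and> sorted_wrt (\<lambda>p q. above ori (fst p) (fst q)) L"
proof (induction m)
  case 0
  show ?case by (intro exI[of _ "[]"]) (simp add: decomposition_def)
next
  case (Suc m)
  then obtain K L where T: "decomposition ori I x m (K @ map (\<lambda>(i, c). (i, m, c)) L)"
    and K: "\<forall>(i, j, c)\<in>set K. j < m" and L: "sorted_wrt (\<lambda>p q. above ori (fst p) (fst q)) L" by blast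
  show ?case
  proof (cases "Suc m \<in> I")
    case False
    \<comment> \<open>At a gap of \<open>I\<close> all open intervals count as closed at
      \<open>m\<close>, and the deque becomes empty.\<close>
    then show ?thesis using K decomposition_skip[OF T False x(1) x(2)[OF False]]
      by (intro exI[of _ "K @ map (\<lambda>(i, c). (i, m, c)) L"] exI[of _ "[]"]) auto
  next
    case True
    \<comment> \<open>The head of \<open>M\<close> is the end of the deque that the arrow at
      \<open>m\<close> selects.\<close>
    define M where "M = (if ori m then L else rev L)"
    have M1: "sorted_wrt (\<lambda>p q. pops_before ori m (fst p) (fst q)) M"
      using L by (auto simp: M_def pops_before_def sorted_wrt_rev)
    have TM: "decomposition ori I x m (K @ map (\<lambda>(i, c). (i, m, c)) M)"
      using T by (simp add: M_def decomposition_rev)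
    have M2: "1 \<le> fst t \<and> fst t \<le> m \<and> 0 \<le> snd t" if "t \<in> set M" for t
    proof -
      have "(fst t, m, snd t) \<in> set (K @ map (\<lambda>(i, c). (i, m, c)) M)"
        using that by (auto simp: image_iff split_beta intro!: bexI[of _ t])
      then show ?thesis using TM unfolding decomposition_def by blast
    qed
    have M3: "x m = (\<Sum>(i, c)\<leftarrow>M. c)"
    \<comment> \<open>For \<open>m = 0\<close> no left end is possible, so \<open>M\<close> is
      empty, and \<open>x 0\<close> is 0 because 0 lies outside \<open>I\<close>.\<close>
    proof (cases "m = 0")
      case True
      then show ?thesis using M2 x(2)[OF I] by (cases M) force+
    next
      case False
      have "(\<Sum>(i, j, c)\<leftarrow>K. if i \<le> m \<and> m \<le> j then c else 0) = (\<Sum>t\<leftarrow>K. 0)"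
        using K by (intro arg_cong[of _ _ sum_list] map_cong) force+
      moreover have "(\<Sum>(i, j, c)\<leftarrow>map (\<lambda>(i, c). (i, m, c)) M. if i \<le> m \<and> m \<le> j then c else 0) = (\<Sum>(i, c)\<leftarrow>M. c)"
        unfolding map_map comp_def using M2 by (intro arg_cong[of _ _ sum_list] map_cong) auto
      moreover have "x m = (\<Sum>(i, j, c)\<leftarrow>K @ map (\<lambda>(i, c). (i, m, c)) M. if i \<le> m \<and> m \<le> j then c else 0)"
      proof -
        have "\<forall>v\<in>{1..m}. x v = (\<Sum>(i, j, c)\<leftarrow>K @ map (\<lambda>(i, c). (i, m, c)) M. if i \<le> v \<and> v \<le> j then c else 0)"
          using TM unfolding decomposition_def by blast
        then show ?thesis by (rule bspec) (use False in simp)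
      qed
      ultimately show ?thesis by (simp only: map_append sum_list_append) simp
    qed
    obtain C N where CN: "fst ` set C \<subseteq> fst ` set M" "fst ` set N \<subseteq> insert (Suc m) (fst ` set M)"
      "length C + length N = Suc (length M)" "distinct (map fst C)" "sorted_wrt (\<lambda>p q. pops_before ori m (fst p) (fst q)) N"
      "\<forall>t\<in>set C \<union> set N. 0 \<le> snd t"
      "\<forall>p\<in>set C. \<forall>q\<in>set N. fst q \<le> m \<and> (fst p = fst q \<or> pops_before ori m (fst p) (fst q))"
      "\<forall>v\<le>m. (\<Sum>(i, c)\<leftarrow>M. if i \<le> v then c else 0) =
         (\<Sum>(i, c)\<leftarrow>C. if i \<le> v then c else 0) + (\<Sum>(i, c)\<leftarrow>N. if i \<le> v then c else 0)"
      "(\<Sum>(i, c)\<leftarrow>N. c) = x (Suc m)"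
      "(\<Sum>(i, c)\<leftarrow>C. c) + (\<Sum>(i, c)\<leftarrow>N. c) = (\<Sum>(i, c)\<leftarrow>M. c) + max 0 (x (Suc m) - x m)"
      using deque_step[of ori m M x, OF M1 M2 M3 x(1) x(1)] by blast
    let ?L = "if ori m then N else rev N"
    have "decomposition ori I x (Suc m) ((K @ map (\<lambda>(i, c). (i, m, c)) C) @ map (\<lambda>(i, c). (i, Suc m, c)) ?L)"
      using decomposition_extend[OF TM K True CN] by (simp add: decomposition_rev flip: append_assoc)
    moreover have "sorted_wrt (\<lambda>p q. above ori (fst p) (fst q)) ?L"
      using CN(5) by (auto simp: pops_before_def sorted_wrt_rev)
    moreover have "\<forall>(i, j, c)\<in>set (K @ map (\<lambda>(i, c). (i, m, c)) C). j < Suc m"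
      using K by auto
    ultimately show ?thesis by blast
  qed
qed

section \<open>Thin modules and tilting lists\<close>

definition thin_rep :: "(nat \<Rightarrow> bool) \<Rightarrow> nat set \<Rightarrow> 'k::field rep" where
  "thin_rep ori S =
     \<lparr> rdim = (\<lambda>i. if i \<in> S then 1 else 0),
       rmap = (\<lambda>a. mat (if tgt ori a \<in> S then 1 else 0) (if src ori a \<in> S then 1 else 0) (\<lambda>_. 1)) \<rparr>"

lemma rdim_thin_rep: "rdim (thin_rep ori S) i = (if i \<in> S then 1 else 0)"
  by (simp add: thin_rep_def)

lemma is_rep_thin_rep: "S \<subseteq> {1..n} \<Longrightarrow> is_rep n ori (thin_rep ori S)"
  by (auto simp: is_rep_def thin_rep_def)

lemma src_tgt_bounds:
  assumes "a \<in> {1..<n}"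
  shows "src ori a \<in> {1..n}" "tgt ori a \<in> {1..n}"
  using assms by (auto simp: src_def tgt_def)

lemma rmap_carrier:
  "is_rep n ori V \<Longrightarrow> a \<in> {1..<n} \<Longrightarrow> rmap V a \<in> carrier_mat (rdim V (tgt ori a)) (rdim V (src ori a))"
  by (simp add: is_rep_def)

text \<open>The splitting equations for thin modules, as scalars: \<open>g\<close> lives on
  \<open>A \<inter> B\<close>, where both modules are nonzero. By \<open>ext_free\<close>, all
  equations have their right vertex there, or all have their left vertex there. Each then defines
  its own unknown from the neighbouring one.\<close>

lemma potential_exists:
  fixes h :: "nat \<Rightarrow> 'k::field"
  assumes "ext_free ori A B"
  shows "\<exists>g. (\<forall>i. i \<notin> A \<inter> B \<longrightarrow> g i = 0) \<and>
    (\<forall>a\<in>{1..<n}. src ori a \<in> A \<and> tgt ori a \<in> B \<longrightarrow> h a = g (tgt ori a) - g (src ori a))"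
proof -
  define R where "R a \<longleftrightarrow> src ori a \<in> A \<and> tgt ori a \<in> B" for a
  consider (right) "\<forall>a. R a \<longrightarrow> Suc a \<in> A \<inter> B" | (left) "\<forall>a. R a \<longrightarrow> a \<in> A \<inter> B"
    using assms unfolding ext_free_def R_def by blast
  then show ?thesis
  proof cases
    case right
    \<comment> \<open>An unknown that no equation determines gets the value 0, which also makes
      \<open>g\<close> vanish outside the intersection.\<close>
    define g where "g = rec_nat 0 (\<lambda>a y. if R a then if ori a then y + h a else y - h a else 0)"
    have g: "g (Suc a) = (if R a then if ori a then g a + h a else g a - h a else 0)" "g 0 = 0" for a
      by (simp_all add: g_def)
    have "g i = 0" if "i \<notin> A \<inter> B" for i
      using right that by (cases i) (auto simp: g)
    moreover have "h a = g (tgt ori a) - g (src ori a)" if "R a" for a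
      using that by (simp add: src_def tgt_def g)
    ultimately show ?thesis unfolding R_def by blast
  next
    case left
    \<comment> \<open>The recursion descends from the value 0 at vertex \<open>n\<close>:
      \<open>g' k\<close> belongs to the vertex \<open>n - k\<close>.\<close>
    define g' where "g' = rec_nat 0 (\<lambda>k y. if R (n - Suc k) then if ori (n - Suc k) then y - h (n - Suc k) else y + h (n - Suc k) else 0)"
    define g where "g i = (if i < n then g' (n - i) else 0)" for i
    have g'0: "g' 0 = 0" by (simp add: g'_def)
    have g: "g a = (if R a then if ori a then g (Suc a) - h a else g (Suc a) + h a else 0)" if a: "a < n" for a
    proof -
      obtain k where k: "n - a = Suc k" "n - Suc a = k" "n - Suc k = a" using a
        by (metis Suc_diff_Suc diff_diff_cancel less_imp_le_nat)
      then show ?thesis using a g'0 by (auto simp: g_def g'_def)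
    qed
    have "g i = 0" if "i \<notin> A \<inter> B" for i
      using left that by (cases "i < n") (force simp: g, simp add: g_def)
    moreover have "h a = g (tgt ori a) - g (src ori a)" if "R a" "a < n" for a
      using that g[of a] by (simp add: src_def tgt_def)
    ultimately show ?thesis unfolding R_def by (meson atLeastLessThan_iff)
  qed
qed

lemma ext1_zero_thin_rep:
  assumes "ext_free ori A B"
  shows "ext1_zero n ori (thin_rep ori A) (thin_rep ori B :: 'k::field rep)"
  unfolding ext1_zero_def
proof (intro allI impI)
  let ?M = "thin_rep ori A :: 'k rep" and ?N = "thin_rep ori B :: 'k rep"
  fix h :: "nat \<Rightarrow> 'k mat" assume h: "\<forall>a\<in>{1..<n}. h a \<in> carrier_mat (rdim ?N (tgt ori a)) (rdim ?M (src ori a))"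
  obtain g where g: "\<forall>i. i \<notin> A \<inter> B \<longrightarrow> g i = 0"
    "\<forall>a\<in>{1..<n}. src ori a \<in> A \<and> tgt ori a \<in> B \<longrightarrow> h a $$ (0, 0) = g (tgt ori a) - g (src ori a)"
    using potential_exists[OF assms, of n "\<lambda>a. h a $$ (0, 0)"] by blast
  let ?f = "\<lambda>i. mat (rdim ?N i) (rdim ?M i) (\<lambda>_. g i)"
  have "h a = ?f (tgt ori a) * rmap ?M a - rmap ?N a * ?f (src ori a)" if a: "a \<in> {1..<n}" for a
    using a g h[rule_format, OF a]
    by (intro eq_matI) (auto simp: thin_rep_def scalar_prod_def split: if_splits)
  then show "\<exists>f. (\<forall>i\<in>{1..n}. f i \<in> carrier_mat (rdim ?N i) (rdim ?M i)) \<and>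
      (\<forall>a\<in>{1..<n}. h a = f (tgt ori a) * rmap ?M a - rmap ?N a * f (src ori a))"
    by (intro exI[of _ ?f]) auto
qed

section \<open>Ext and direct sums\<close>

lemma rdim_rep_dsum: "rdim (rep_dsum ori V W) i = rdim V i + rdim W i"
  by (simp add: rep_dsum_def)

lemma is_rep_dsum:
  assumes "is_rep n ori V" "is_rep n ori W"
  shows "is_rep n ori (rep_dsum ori V W)"
  using assms unfolding is_rep_def rep_dsum_def by auto

text \<open>With a lower block row of height 0, \<open>four_block_mat\<close> is the row
  \<open>[B C]\<close>, the shape of a map out of a direct sum. In \<open>mult_vblock\<close> a
  block column of width 0 serves for maps into one.\<close>

lemma mult_hblock:
  assumes "A \<in> carrier_mat r m" "B \<in> carrier_mat m c" "C \<in> carrier_mat m d"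
  shows "A * four_block_mat B C (0\<^sub>m 0 c) (0\<^sub>m 0 d) = four_block_mat (A * B) (A * C) (0\<^sub>m 0 c) (0\<^sub>m 0 d)"
proof (intro eq_matI)
  fix i j assume ij: "i < dim_row (four_block_mat (A * B) (A * C) (0\<^sub>m 0 c) (0\<^sub>m 0 d))"
    "j < dim_col (four_block_mat (A * B) (A * C) (0\<^sub>m 0 c) (0\<^sub>m 0 d))"
  then have "col (four_block_mat B C (0\<^sub>m 0 c) (0\<^sub>m 0 d)) j = (if j < c then col B j else col C (j - c))"
    using assms by (intro eq_vecI) auto
  then show "(A * four_block_mat B C (0\<^sub>m 0 c) (0\<^sub>m 0 d)) $$ (i, j) =
      four_block_mat (A * B) (A * C) (0\<^sub>m 0 c) (0\<^sub>m 0 d) $$ (i, j)"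
    using assms ij by simp
qed (use assms in auto)

lemma mult_vblock:
  assumes "A \<in> carrier_mat r m" "B \<in> carrier_mat s m" "C \<in> carrier_mat m c"
  shows "four_block_mat A (0\<^sub>m r 0) B (0\<^sub>m s 0) * C = four_block_mat (A * C) (0\<^sub>m r 0) (B * C) (0\<^sub>m s 0)"
proof (intro eq_matI)
  fix i j assume ij: "i < dim_row (four_block_mat (A * C) (0\<^sub>m r 0) (B * C) (0\<^sub>m s 0))"
    "j < dim_col (four_block_mat (A * C) (0\<^sub>m r 0) (B * C) (0\<^sub>m s 0))"
  then have "row (four_block_mat A (0\<^sub>m r 0) B (0\<^sub>m s 0)) i = (if i < r then row A i else row B (i - r))"
    using assms by (intro eq_vecI) auto
  then show "(four_block_mat A (0\<^sub>m r 0) B (0\<^sub>m s 0) * C) $$ (i, j) =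
      four_block_mat (A * C) (0\<^sub>m r 0) (B * C) (0\<^sub>m s 0) $$ (i, j)"
    using assms ij by simp
qed (use assms in auto)

lemma zero_mat_minus_self: "0\<^sub>m r c - 0\<^sub>m r c = (0\<^sub>m r c :: 'a::group_add mat)"
  by (intro eq_matI) auto

lemma four_block_mat_minus:
  fixes A B C D :: "'a::group_add mat"
  assumes "A \<in> carrier_mat r c" "B \<in> carrier_mat r d" "C \<in> carrier_mat s c" "D \<in> carrier_mat s d"
    "A' \<in> carrier_mat r c" "B' \<in> carrier_mat r d" "C' \<in> carrier_mat s c" "D' \<in> carrier_mat s d"
  shows "four_block_mat (A - A') (B - B') (C - C') (D - D') = four_block_mat A B C D - four_block_mat A' B' C' D'"
  using assms by (intro eq_matI) auto

text \<open>The maps of the direct sum are block diagonal, so the two column blocks of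
  \<open>h\<close> can be split independently. The dual statement does the same with row
  blocks.\<close>

lemma ext1_zero_dsum_left:
  fixes V W N :: "'k::field rep"
  assumes rep: "is_rep n ori V" "is_rep n ori W" "is_rep n ori N"
    and ext: "ext1_zero n ori V N" "ext1_zero n ori W N"
  shows "ext1_zero n ori (rep_dsum ori V W) N"
  unfolding ext1_zero_def rdim_rep_dsum
proof (intro allI impI)
  fix h :: "nat \<Rightarrow> 'k mat" assume h: "\<forall>a\<in>{1..<n}. h a \<in> carrier_mat (rdim N (tgt ori a)) (rdim V (src ori a) + rdim W (src ori a))"
  define h1 where "h1 a = mat (rdim N (tgt ori a)) (rdim V (src ori a)) (\<lambda>(r, c). h a $$ (r, c))" for a
  define h2 where "h2 a = mat (rdim N (tgt ori a)) (rdim W (src ori a)) (\<lambda>(r, c). h a $$ (r, c + rdim V (src ori a)))" for a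
  obtain f1 where f1: "\<forall>i\<in>{1..n}. f1 i \<in> carrier_mat (rdim N i) (rdim V i)"
    "\<forall>a\<in>{1..<n}. h1 a = f1 (tgt ori a) * rmap V a - rmap N a * f1 (src ori a)"
    using ext(1)[unfolded ext1_zero_def, rule_format, of h1] by (auto simp: h1_def)
  obtain f2 where f2: "\<forall>i\<in>{1..n}. f2 i \<in> carrier_mat (rdim N i) (rdim W i)"
    "\<forall>a\<in>{1..<n}. h2 a = f2 (tgt ori a) * rmap W a - rmap N a * f2 (src ori a)"
    using ext(2)[unfolded ext1_zero_def, rule_format, of h2] by (auto simp: h2_def)
  let ?f = "\<lambda>i. four_block_mat (f1 i) (f2 i) (0\<^sub>m 0 (rdim V i)) (0\<^sub>m 0 (rdim W i))"
  have eq: "h a = ?f (tgt ori a) * rmap (rep_dsum ori V W) a - rmap N a * ?f (src ori a)" if a: "a \<in> {1..<n}" for a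
  proof -
    let ?s = "src ori a" and ?t = "tgt ori a"
    note st = src_tgt_bounds[OF a, of ori]
    have c [simp]: "f1 ?s \<in> carrier_mat (rdim N ?s) (rdim V ?s)" "f1 ?t \<in> carrier_mat (rdim N ?t) (rdim V ?t)"
      "f2 ?s \<in> carrier_mat (rdim N ?s) (rdim W ?s)" "f2 ?t \<in> carrier_mat (rdim N ?t) (rdim W ?t)"
      "rmap V a \<in> carrier_mat (rdim V ?t) (rdim V ?s)" "rmap W a \<in> carrier_mat (rdim W ?t) (rdim W ?s)"
      "rmap N a \<in> carrier_mat (rdim N ?t) (rdim N ?s)"
      "h a \<in> carrier_mat (rdim N ?t) (rdim V ?s + rdim W ?s)"
      using f1(1) f2(1) st rep[THEN rmap_carrier, OF a] h a by auto
    note d [simp] = c[THEN carrier_matD(1)] c[THEN carrier_matD(2)]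
    have "?f ?t * rmap (rep_dsum ori V W) a =
        four_block_mat (f1 ?t * rmap V a) (f2 ?t * rmap W a) (0\<^sub>m 0 (rdim V ?s)) (0\<^sub>m 0 (rdim W ?s))"
      unfolding rep_dsum_def rep.simps
      by (subst mult_four_block_mat[where ?nr1.0 = "rdim N ?t" and ?n1.0 = "rdim V ?t" and ?n2.0 = "rdim W ?t"
          and ?nr2.0 = 0 and ?nc1.0 = "rdim V ?s" and ?nc2.0 = "rdim W ?s"])
        (auto intro!: cong_four_block_mat eq_matI)
    moreover have "rmap N a * ?f ?s =
        four_block_mat (rmap N a * f1 ?s) (rmap N a * f2 ?s) (0\<^sub>m 0 (rdim V ?s)) (0\<^sub>m 0 (rdim W ?s))"
      by (rule mult_hblock) (rule c)+
    ultimately have "?f ?t * rmap (rep_dsum ori V W) a - rmap N a * ?f ?s =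
        four_block_mat (f1 ?t * rmap V a - rmap N a * f1 ?s) (f2 ?t * rmap W a - rmap N a * f2 ?s)
          (0\<^sub>m 0 (rdim V ?s) - 0\<^sub>m 0 (rdim V ?s)) (0\<^sub>m 0 (rdim W ?s) - 0\<^sub>m 0 (rdim W ?s))"
      by (subst four_block_mat_minus[where r = "rdim N ?t" and s = 0 and c = "rdim V ?s" and d = "rdim W ?s"])
        (simp_all add: mult_carrier_mat[OF c(2) c(5)] mult_carrier_mat[OF c(4) c(6)]
          mult_carrier_mat[OF c(7) c(1)] mult_carrier_mat[OF c(7) c(3)])
    also have "\<dots> = four_block_mat (h1 a) (h2 a) (0\<^sub>m 0 (rdim V ?s)) (0\<^sub>m 0 (rdim W ?s))"
      using f1(2) f2(2) a by (simp add: zero_mat_minus_self)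
    also have "\<dots> = h a"
      by (intro eq_matI) (auto simp: h1_def h2_def)
    finally show ?thesis by simp
  qed
  show "\<exists>f. (\<forall>i\<in>{1..n}. f i \<in> carrier_mat (rdim N i) (rdim V i + rdim W i)) \<and>
      (\<forall>a\<in>{1..<n}. h a = f (tgt ori a) * rmap (rep_dsum ori V W) a - rmap N a * f (src ori a))"
  proof (rule exI[of _ ?f], intro conjI ballI)
    fix i assume "i \<in> {1..n}"
    then show "?f i \<in> carrier_mat (rdim N i) (rdim V i + rdim W i)"
      using f1(1) four_block_carrier_mat[of "f1 i" "rdim N i" "rdim V i" "0\<^sub>m 0 (rdim W i)" 0 "rdim W i"] by simp
  qed (rule eq)
qed

lemma ext1_zero_dsum_right:
  fixes V W M :: "'k::field rep"
  assumes rep: "is_rep n ori V" "is_rep n ori W" "is_rep n ori M"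
    and ext: "ext1_zero n ori M V" "ext1_zero n ori M W"
  shows "ext1_zero n ori M (rep_dsum ori V W)"
  unfolding ext1_zero_def rdim_rep_dsum
proof (intro allI impI)
  fix h :: "nat \<Rightarrow> 'k mat" assume h: "\<forall>a\<in>{1..<n}. h a \<in> carrier_mat (rdim V (tgt ori a) + rdim W (tgt ori a)) (rdim M (src ori a))"
  define h1 where "h1 a = mat (rdim V (tgt ori a)) (rdim M (src ori a)) (\<lambda>(r, c). h a $$ (r, c))" for a
  define h2 where "h2 a = mat (rdim W (tgt ori a)) (rdim M (src ori a)) (\<lambda>(r, c). h a $$ (r + rdim V (tgt ori a), c))" for a
  obtain f1 where f1: "\<forall>i\<in>{1..n}. f1 i \<in> carrier_mat (rdim V i) (rdim M i)"
    "\<forall>a\<in>{1..<n}. h1 a = f1 (tgt ori a) * rmap M a - rmap V a * f1 (src ori a)"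
    using ext(1)[unfolded ext1_zero_def, rule_format, of h1] by (auto simp: h1_def)
  obtain f2 where f2: "\<forall>i\<in>{1..n}. f2 i \<in> carrier_mat (rdim W i) (rdim M i)"
    "\<forall>a\<in>{1..<n}. h2 a = f2 (tgt ori a) * rmap M a - rmap W a * f2 (src ori a)"
    using ext(2)[unfolded ext1_zero_def, rule_format, of h2] by (auto simp: h2_def)
  let ?f = "\<lambda>i. four_block_mat (f1 i) (0\<^sub>m (rdim V i) 0) (f2 i) (0\<^sub>m (rdim W i) 0)"
  have eq: "h a = ?f (tgt ori a) * rmap M a - rmap (rep_dsum ori V W) a * ?f (src ori a)" if a: "a \<in> {1..<n}" for a
  proof -
    let ?s = "src ori a" and ?t = "tgt ori a"
    note st = src_tgt_bounds[OF a, of ori]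
    have c [simp]: "f1 ?s \<in> carrier_mat (rdim V ?s) (rdim M ?s)" "f1 ?t \<in> carrier_mat (rdim V ?t) (rdim M ?t)"
      "f2 ?s \<in> carrier_mat (rdim W ?s) (rdim M ?s)" "f2 ?t \<in> carrier_mat (rdim W ?t) (rdim M ?t)"
      "rmap V a \<in> carrier_mat (rdim V ?t) (rdim V ?s)" "rmap W a \<in> carrier_mat (rdim W ?t) (rdim W ?s)"
      "rmap M a \<in> carrier_mat (rdim M ?t) (rdim M ?s)"
      "h a \<in> carrier_mat (rdim V ?t + rdim W ?t) (rdim M ?s)"
      using f1(1) f2(1) st rep[THEN rmap_carrier, OF a] h a by auto
    note d [simp] = c[THEN carrier_matD(1)] c[THEN carrier_matD(2)]
    have "rmap (rep_dsum ori V W) a * ?f ?s =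
        four_block_mat (rmap V a * f1 ?s) (0\<^sub>m (rdim V ?t) 0) (rmap W a * f2 ?s) (0\<^sub>m (rdim W ?t) 0)"
      unfolding rep_dsum_def rep.simps
      by (subst mult_four_block_mat[where ?nr1.0 = "rdim V ?t" and ?n1.0 = "rdim V ?s" and ?n2.0 = "rdim W ?s"
          and ?nr2.0 = "rdim W ?t" and ?nc1.0 = "rdim M ?s" and ?nc2.0 = 0])
        (auto intro!: cong_four_block_mat eq_matI)
    moreover have "?f ?t * rmap M a =
        four_block_mat (f1 ?t * rmap M a) (0\<^sub>m (rdim V ?t) 0) (f2 ?t * rmap M a) (0\<^sub>m (rdim W ?t) 0)"
      by (rule mult_vblock) (rule c)+
    ultimately have "?f ?t * rmap M a - rmap (rep_dsum ori V W) a * ?f ?s =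
        four_block_mat (f1 ?t * rmap M a - rmap V a * f1 ?s) (0\<^sub>m (rdim V ?t) 0 - 0\<^sub>m (rdim V ?t) 0)
          (f2 ?t * rmap M a - rmap W a * f2 ?s) (0\<^sub>m (rdim W ?t) 0 - 0\<^sub>m (rdim W ?t) 0)"
      by (subst four_block_mat_minus[where r = "rdim V ?t" and s = "rdim W ?t" and c = "rdim M ?s" and d = 0])
        (simp_all add: mult_carrier_mat[OF c(2) c(7)] mult_carrier_mat[OF c(4) c(7)]
          mult_carrier_mat[OF c(5) c(1)] mult_carrier_mat[OF c(6) c(3)])
    also have "\<dots> = four_block_mat (h1 a) (0\<^sub>m (rdim V ?t) 0) (h2 a) (0\<^sub>m (rdim W ?t) 0)"
      using f1(2) f2(2) a by (simp add: zero_mat_minus_self)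
    also have "\<dots> = h a"
      by (intro eq_matI) (auto simp: h1_def h2_def)
    finally show ?thesis by simp
  qed
  show "\<exists>f. (\<forall>i\<in>{1..n}. f i \<in> carrier_mat (rdim V i + rdim W i) (rdim M i)) \<and>
      (\<forall>a\<in>{1..<n}. h a = f (tgt ori a) * rmap M a - rmap (rep_dsum ori V W) a * f (src ori a))"
  proof (rule exI[of _ ?f], intro conjI ballI)
    fix i assume "i \<in> {1..n}"
    then show "?f i \<in> carrier_mat (rdim V i + rdim W i) (rdim M i)"
      using f1(1) four_block_carrier_mat[of "f1 i" "rdim V i" "rdim M i" "0\<^sub>m (rdim W i) 0" "rdim W i" 0] by simp
  qed (rule eq)
qed

lemma is_rep_zero_rep: "is_rep n ori zero_rep"
  by (simp add: is_rep_def zero_rep_def)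

lemma is_rep_dsum_list: "(\<And>X. X \<in> set Xs \<Longrightarrow> is_rep n ori X) \<Longrightarrow> is_rep n ori (rep_dsum_list ori Xs)"
  by (induction Xs) (auto simp: rep_dsum_list_def is_rep_zero_rep is_rep_dsum)

lemma ext1_zero_zero_rep: "is_rep n ori N \<Longrightarrow> ext1_zero n ori zero_rep N" "is_rep n ori N \<Longrightarrow> ext1_zero n ori N zero_rep"
proof -
  assume N: "is_rep n ori N"
  show "ext1_zero n ori zero_rep N"
    unfolding ext1_zero_def
  proof (intro allI impI exI[of _ "\<lambda>i. 0\<^sub>m (rdim N i) 0"] conjI ballI eq_matI)
  qed (auto simp: zero_rep_def rmap_carrier[OF N, THEN carrier_matD(1)] rmap_carrier[OF N, THEN carrier_matD(2)])
  show "ext1_zero n ori N zero_rep"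
    unfolding ext1_zero_def
  proof (intro allI impI exI[of _ "\<lambda>i. 0\<^sub>m 0 (rdim N i)"] conjI ballI eq_matI)
  qed (auto simp: zero_rep_def rmap_carrier[OF N, THEN carrier_matD(1)] rmap_carrier[OF N, THEN carrier_matD(2)])
qed

lemma ext1_zero_dsum_list_right:
  assumes "is_rep n ori M" "\<And>X. X \<in> set Xs \<Longrightarrow> is_rep n ori X \<and> ext1_zero n ori M X"
  shows "ext1_zero n ori M (rep_dsum_list ori Xs)"
  using assms(2)
proof (induction Xs)
  case (Cons X Xs)
  then have "ext1_zero n ori M (rep_dsum ori X (rep_dsum_list ori Xs))"
    using assms(1) by (intro ext1_zero_dsum_right is_rep_dsum_list) auto
  then show ?case by (simp add: rep_dsum_list_def)
qed (use assms(1) in \<open>simp add: rep_dsum_list_def ext1_zero_zero_rep\<close>)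

lemma ext1_zero_dsum_list_left:
  assumes "is_rep n ori N" "\<And>X. X \<in> set Xs \<Longrightarrow> is_rep n ori X \<and> ext1_zero n ori X N"
  shows "ext1_zero n ori (rep_dsum_list ori Xs) N"
  using assms(2)
proof (induction Xs)
  case (Cons X Xs)
  then have "ext1_zero n ori (rep_dsum ori X (rep_dsum_list ori Xs)) N"
    using assms(1) by (intro ext1_zero_dsum_left is_rep_dsum_list) auto
  then show ?case by (simp add: rep_dsum_list_def)
qed (use assms(1) in \<open>simp add: rep_dsum_list_def ext1_zero_zero_rep\<close>)

lemma ext1_zero_dsum_list:
  assumes "\<And>X. X \<in> set Xs \<Longrightarrow> is_rep n ori X" "\<And>X Y. X \<in> set Xs \<Longrightarrow> Y \<in> set Xs \<Longrightarrow> ext1_zero n ori X Y"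
  shows "ext1_zero n ori (rep_dsum_list ori Xs) (rep_dsum_list ori Xs)"
  using assms by (intro ext1_zero_dsum_list_left ext1_zero_dsum_list_right conjI is_rep_dsum_list) auto

section \<open>Indecomposable interval modules and the tilting property\<close>

lemma invertible_mat_dims: "invertible_mat A \<Longrightarrow> dim_row A = dim_col A"
  by (simp add: invertible_mat_def)

lemma rep_iso_rdim: "rep_iso n ori V W \<Longrightarrow> i \<in> {1..n} \<Longrightarrow> rdim V i = rdim W i"
  unfolding rep_iso_def using invertible_mat_dims by fastforce

text \<open>In a decomposition each vertex of the interval would belong to exactly one summand.
  Where the summand changes, the arrow acts as 0 on the direct sum but as 1 on the interval module,
  which forces an invertible \<open>g ?t\<close> to be 0.\<close>

lemma indecomposable_thin_rep:
  assumes "1 \<le> i" "i \<le> j" "j \<le> n"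
  shows "indecomposable n ori (thin_rep ori {i..j} :: 'k::field rep)"
  unfolding indecomposable_def
proof (intro conjI notI)
  let ?M = "thin_rep ori {i..j} :: 'k rep"
  show "is_rep n ori ?M" using assms by (intro is_rep_thin_rep) auto
  show "rep_nonzero ?M" using assms by (auto simp: rep_nonzero_def rdim_thin_rep)
  assume "\<exists>V W. is_rep n ori V \<and> is_rep n ori W \<and> rep_nonzero V \<and> rep_nonzero W \<and> rep_iso n ori ?M (rep_dsum ori V W)"
  then obtain V W :: "'k rep" where VW: "is_rep n ori V" "is_rep n ori W" "rep_nonzero V" "rep_nonzero W"
    "rep_iso n ori ?M (rep_dsum ori V W)" by blast
  have dim: "rdim V t + rdim W t = (if t \<in> {i..j} then 1 else 0)" for t
    using rep_iso_rdim[OF VW(5), of t] VW(1,2) assms unfolding is_rep_def rdim_rep_dsum rdim_thin_rep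
    by (cases "t \<in> {1..n}") auto
  have "\<exists>a\<in>{i..<j}. rdim V a \<noteq> rdim V (Suc a)"
  proof (rule ccontr)
    assume *: "\<not> ?thesis"
    have c: "rdim V (i + k) = rdim V i" if "i + k \<le> j" for k
      using that
    proof (induction k)
      case (Suc k)
      then show ?case using *[unfolded bex_simps, THEN bspec, of "i + k"] by auto
    qed simp
    have c: "rdim V t = rdim V i" if "t \<in> {i..j}" for t
      using c[of "t - i"] that by auto
    obtain p q where pq: "rdim V p \<noteq> 0" "rdim W q \<noteq> 0" using VW(3,4) unfolding rep_nonzero_def by blast
    then have "p \<in> {i..j}" "q \<in> {i..j}" using dim[of p] dim[of q] by (auto split: if_splits)
    then show False using c[of p] c[of q] dim[of q] dim[of p] pq by simp
  qed
  then obtain a where a: "a \<in> {i..<j}" "rdim V a \<noteq> rdim V (Suc a)" by blast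
  let ?s = "src ori a" and ?t = "tgt ori a"
  have an: "a \<in> {1..<n}" using a assms by auto
  obtain g where g: "\<forall>i\<in>{1..n}. g i \<in> carrier_mat (rdim (rep_dsum ori V W) i) (rdim ?M i) \<and> invertible_mat (g i)"
    "g ?t * rmap ?M a = rmap (rep_dsum ori V W) a * g ?s"
    using VW(5) an unfolding rep_iso_def by blast
  have st: "?s \<in> {i..j}" "?t \<in> {i..j}" using a by (auto simp: src_def tgt_def)
  have ne: "rdim V ?s \<noteq> rdim V ?t" using a by (auto simp: src_def tgt_def)
  have gc: "g ?s \<in> carrier_mat 1 1" "g ?t \<in> carrier_mat 1 1" "invertible_mat (g ?t)"
    using g(1)[THEN bspec, OF src_tgt_bounds(1)[OF an, of ori]] g(1)[THEN bspec, OF src_tgt_bounds(2)[OF an, of ori]] st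
    by (simp_all add: rdim_rep_dsum rdim_thin_rep dim)
  have Vc: "rmap V a \<in> carrier_mat (rdim V ?t) (rdim V ?s)" "rmap W a \<in> carrier_mat (rdim W ?t) (rdim W ?s)"
    using VW(1,2) an by (auto simp: is_rep_def)
  have "rdim V ?s = 1 \<and> rdim W ?s = 0 \<and> rdim V ?t = 0 \<and> rdim W ?t = 1 \<or>
        rdim V ?s = 0 \<and> rdim W ?s = 1 \<and> rdim V ?t = 1 \<and> rdim W ?t = 0"
    using dim[of ?s] dim[of ?t] st ne by auto
  then have "rmap (rep_dsum ori V W) a = 0\<^sub>m 1 1"
    using Vc by (intro eq_matI) (auto simp: rep_dsum_def)
  moreover have "rmap ?M a = 1\<^sub>m 1"
    using st by (intro eq_matI) (auto simp: thin_rep_def)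
  ultimately have "g ?t = 0\<^sub>m 1 1" using g(2) gc by simp
  then have "invertible_mat (0\<^sub>m 1 1 :: 'k mat)" using gc(3) by simp
  then obtain B where B: "inverts_mat (0\<^sub>m 1 1) B" "inverts_mat B (0\<^sub>m 1 1 :: 'k mat)"
    unfolding invertible_mat_def by blast
  have "dim_row B = 1" using arg_cong[OF B(2)[unfolded inverts_mat_def], of dim_col] by simp
  moreover have "dim_col B = 1" using arg_cong[OF B(1)[unfolded inverts_mat_def], of dim_col] by simp
  ultimately have "B \<in> carrier_mat 1 1" by (rule carrier_matI)
  then have "0\<^sub>m 1 1 * B = 0\<^sub>m 1 1" by (rule left_mult_zero_mat)
  then have "(0\<^sub>m 1 1 :: 'k mat) = 1\<^sub>m 1" using B(1)[unfolded inverts_mat_def] by (metis index_zero_mat(2))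
  then have "(0\<^sub>m 1 1 :: 'k mat) $$ (0, 0) = 1\<^sub>m 1 $$ (0, 0)" by (rule arg_cong)
  then show False by simp
qed

lemma tilting_list_decomposition:
  assumes T: "decomposition ori I x n T" and I: "I \<subseteq> {1..n}"
  shows "tilting_list n ori I (map (\<lambda>(i, j, c). thin_rep ori {i..j} :: 'k::field rep) T)" (is "tilting_list n ori I ?Xs")
proof -
  have T1: "1 \<le> i \<and> i \<le> j \<and> j \<le> n \<and> {i..j} \<subseteq> I" if "(i, j, c) \<in> set T" for i j c
    using T that unfolding decomposition_def by blast
  have "length ?Xs = card I"
    using T I by (simp add: decomposition_def Int_absorb2)
  moreover have "indecomposable n ori X \<and> supp X \<subseteq> I \<and> is_rep n ori X" if "X \<in> set ?Xs" for X
  proof -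
    obtain i j c where "(i, j, c) \<in> set T" "X = thin_rep ori {i..j}" using \<open>X \<in> set ?Xs\<close> by auto
    then show ?thesis using T1 indecomposable_thin_rep[of i j n ori] 
      by (fastforce simp: indecomposable_def supp_def rdim_thin_rep split: if_splits)
  qed
  moreover have "\<not> rep_iso n ori (?Xs ! p) (?Xs ! q)" if "p < length ?Xs" "q < length ?Xs" "p \<noteq> q" for p q
  proof
    assume iso: "rep_iso n ori (?Xs ! p) (?Xs ! q)"
    obtain i j c k l d where pq: "T ! p = (i, j, c)" "T ! q = (k, l, d)" by (metis prod_cases3)
    have "(i, j, c) \<in> set T" "(k, l, d) \<in> set T" using pq that by (metis length_map nth_mem)+
    then have b: "1 \<le> i" "i \<le> j" "j \<le> n" "1 \<le> k" "k \<le> l" "l \<le> n" using T1 by blast+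
    have "(t \<in> {i..j}) = (t \<in> {k..l})" if "t \<in> {1..n}" for t
      using rep_iso_rdim[OF iso that] pq \<open>p < _\<close> \<open>q < _\<close> by (auto simp: rdim_thin_rep split: if_splits)
    then have "{i..j} \<inter> {1..n} = {k..l} \<inter> {1..n}" by blast
    then have "{i..j} = {k..l}" using b by (simp add: Int_absorb2 subset_iff)
    then have "i = k \<and> j = l" using b by (simp add: Icc_eq_Icc)
    moreover have "distinct (map (\<lambda>(i, j, c). (i, j)) T)" using T by (simp add: decomposition_def)
    moreover have "map (\<lambda>(i, j, c). (i, j)) T ! p = (i, j)" "map (\<lambda>(i, j, c). (i, j)) T ! q = (k, l)"
      using pq that by simp_all
    ultimately show False using that nth_eq_iff_index_eq[of "map (\<lambda>(i, j, c). (i, j)) T" p q] by simp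
  qed
  moreover have "ext1_zero n ori X Y" if "X \<in> set ?Xs" "Y \<in> set ?Xs" for X Y
    using that T unfolding decomposition_def by (fastforce intro!: ext1_zero_thin_rep)
  ultimately show ?thesis
    unfolding tilting_list_def by (intro conjI ballI allI impI ext1_zero_dsum_list) blast+
qed

section \<open>Flags and the splitting of indecomposables\<close>

definition vec_subspace :: "nat \<Rightarrow> 'k::field vec set \<Rightarrow> bool" where
  "vec_subspace d U \<longleftrightarrow> U \<subseteq> carrier_vec d \<and> 0\<^sub>v d \<in> U \<and>
     (\<forall>u\<in>U. \<forall>v\<in>U. u + v \<in> U) \<and> (\<forall>a. \<forall>u\<in>U. a \<cdot>\<^sub>v u \<in> U)"

lemma vec_subspaceD:
  assumes "vec_subspace d U"
  shows "U \<subseteq> carrier_vec d" "0\<^sub>v d \<in> U" "u \<in> U \<Longrightarrow> v \<in> U \<Longrightarrow> u + v \<in> U" "u \<in> U \<Longrightarrow> a \<cdot>\<^sub>v u \<in> U"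
    "u \<in> U \<Longrightarrow> u \<in> carrier_vec d"
  using assms by (auto simp: vec_subspace_def)

lemma carrier_vec_SucE:
  assumes "v \<in> carrier_vec (Suc d)"
  obtains a w where "v = vCons a w" "w \<in> carrier_vec d"
  using assms by (cases v) auto

lemma vCons_add: "dim_vec v = dim_vec w \<Longrightarrow> vCons a v + vCons b w = vCons (a + b) (v + w)"
  by (intro eq_vecI) (auto simp: vec_index_vCons)

lemma vCons_smult: "a \<cdot>\<^sub>v vCons b w = vCons (a * b) (a \<cdot>\<^sub>v w)"
  by (intro eq_vecI) (auto simp: vec_index_vCons)

text \<open>Induction on the dimension: if some vector of \<open>U\<close> has a nonzero first
  coordinate, everything is projected along it to the hyperplane of vectors with first coordinate
  0.\<close>

lemma separating_functional:
  fixes U :: "'k::field vec set"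
  assumes "vec_subspace d U" "v \<in> carrier_vec d" "v \<notin> U"
  shows "\<exists>\<phi>\<in>carrier_vec d. (\<forall>u\<in>U. \<phi> \<bullet> u = 0) \<and> \<phi> \<bullet> v = 1"
  using assms
proof (induction d arbitrary: U v)
  case 0
  then have "v = 0\<^sub>v 0" by auto
  then show ?case using 0 vec_subspaceD(2)[of 0 U] by simp
next
  case (Suc d)
  note U = vec_subspaceD[OF Suc.prems(1)]
  obtain a w where v: "v = vCons a w" "w \<in> carrier_vec d"
    using Suc.prems(2) by (rule carrier_vec_SucE)
  define U' where "U' = {z \<in> carrier_vec d. vCons 0 z \<in> U}"
  have U': "vec_subspace d U'"
    unfolding vec_subspace_def
  proof (intro conjI ballI allI)
    show "0\<^sub>v d \<in> U'" using U(2) by (simp add: U'_def zero_vec_Suc)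
    show "y + z \<in> U'" if "y \<in> U'" "z \<in> U'" for y z
      using that U(3)[of "vCons 0 y" "vCons 0 z"] by (auto simp: U'_def vCons_add)
    show "b \<cdot>\<^sub>v z \<in> U'" if "z \<in> U'" for b z
      using that U(4)[of "vCons 0 z" b] by (auto simp: U'_def vCons_smult)
  qed (auto simp: U'_def)
  show ?case
  proof (cases "\<exists>u\<in>U. u $ 0 \<noteq> 0")
    case True
    then obtain u where u: "u \<in> U" "u $ 0 \<noteq> 0" by blast
    obtain b z where bz: "u = vCons b z" "z \<in> carrier_vec d" using U(5)[OF u(1)] by (rule carrier_vec_SucE)
    define w0 where "w0 = inverse b \<cdot>\<^sub>v z"
    have w0: "vCons 1 w0 \<in> U" "w0 \<in> carrier_vec d"
      using U(4)[OF u(1), of "inverse b"] u(2) bz by (simp_all add: w0_def vCons_smult)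
    have red: "y + (- c) \<cdot>\<^sub>v w0 \<in> carrier_vec d \<and> (vCons 0 (y + (- c) \<cdot>\<^sub>v w0) \<in> U \<longleftrightarrow> vCons c y \<in> U)"
      if "y \<in> carrier_vec d" for c y
    proof -
      have "vCons 0 (y + (- c) \<cdot>\<^sub>v w0) = vCons c y + (- c) \<cdot>\<^sub>v vCons 1 w0"
        using that w0 by (simp add: vCons_add vCons_smult)
      moreover have "vCons c y = vCons 0 (y + (- c) \<cdot>\<^sub>v w0) + c \<cdot>\<^sub>v vCons 1 w0"
        using that w0 by (simp add: vCons_add vCons_smult) (auto intro!: eq_vecI)
      ultimately show ?thesis using that w0 U(3) U(4) by (metis add_carrier_vec smult_carrier_vec)
    qed
    have "w + (- a) \<cdot>\<^sub>v w0 \<notin> U'" using red[OF v(2), of a] Suc.prems(3) v(1) by (simp add: U'_def)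
    then obtain \<phi> where \<phi>: "\<phi> \<in> carrier_vec d" "\<forall>u\<in>U'. \<phi> \<bullet> u = 0" "\<phi> \<bullet> (w + (- a) \<cdot>\<^sub>v w0) = 1"
      using Suc.IH[OF U', of "w + (- a) \<cdot>\<^sub>v w0"] red[OF v(2), of a] by blast
    \<comment> \<open>This is \<phi> after the projection along \<open>vCons 1 w0\<close>;
      \<open>eval\<close> confirms it.\<close>
    let ?\<phi> = "vCons (- (\<phi> \<bullet> w0)) \<phi>"
    have eval: "?\<phi> \<bullet> vCons c y = \<phi> \<bullet> (y + (- c) \<cdot>\<^sub>v w0)" if "y \<in> carrier_vec d" for c y
      using that w0 \<phi>(1) by (simp add: scalar_prod_add_distrib[of _ d])
    have "?\<phi> \<bullet> y = 0" if "y \<in> U" for y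
    proof -
      have "y \<in> carrier_vec (Suc d)" using U(5)[OF that] .
      then obtain c x where "y = vCons c x" "x \<in> carrier_vec d" by (rule carrier_vec_SucE)
      then show ?thesis using eval[of x c] \<phi>(2) red[of x c] that by (simp add: U'_def)
    qed
    moreover have "?\<phi> \<bullet> v = 1" using eval[OF v(2), of a] \<phi>(3) v(1) by simp
    ultimately show ?thesis using \<phi>(1) by (intro bexI[of _ ?\<phi>]) auto
  next
    case False
    have U0: "\<exists>z\<in>U'. u = vCons 0 z" if "u \<in> U" for u
      using U(5)[OF that] False that by (elim carrier_vec_SucE) (auto simp: U'_def)
    show ?thesis
    proof (cases "a = 0")
      case True
      then have "w \<notin> U'" using Suc.prems(3) v by (simp add: U'_def)
      then obtain \<phi> where \<phi>: "\<phi> \<in> carrier_vec d" "\<forall>u\<in>U'. \<phi> \<bullet> u = 0" "\<phi> \<bullet> w = 1"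
        using Suc.IH[OF U' v(2)] by blast
      then show ?thesis using True v U0 by (intro bexI[of _ "vCons 0 \<phi>"]) fastforce+
    next
      case False
      \<comment> \<open>Here the first coordinate itself separates, as it vanishes on
        \<open>U\<close> but not at \<open>v\<close>.\<close>
      have "vCons (inverse a) (0\<^sub>v d) \<bullet> u = 0" if "u \<in> U" for u
        using U0[OF that] by (auto simp: U'_def)
      then show ?thesis using False v by (intro bexI[of _ "vCons (inverse a) (0\<^sub>v d)"]) auto
    qed
  qed
qed

lemma mult_mat_zero_vec: "A \<in> carrier_mat r d \<Longrightarrow> A *\<^sub>v 0\<^sub>v d = (0\<^sub>v r :: 'a::semiring_0 vec)"
  by (intro eq_vecI) auto

text \<open>The functional is found by separating the vector \<open>(1, 0)\<close> from the graph
  \<open>{(\<phi> x, g x + l)}\<close>.\<close>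

lemma functional_factors:
  fixes g :: "'k::field mat"
  assumes g: "g \<in> carrier_mat r d" and U: "vec_subspace r U"
    and \<phi>: "\<phi> \<in> carrier_vec d" "\<And>x. x \<in> carrier_vec d \<Longrightarrow> g *\<^sub>v x \<in> U \<Longrightarrow> \<phi> \<bullet> x = 0"
  shows "\<exists>\<psi>\<in>carrier_vec r. (\<forall>u\<in>U. \<psi> \<bullet> u = 0) \<and> transpose_mat g *\<^sub>v \<psi> = \<phi>"
proof -
  note UD = vec_subspaceD[OF U]
  define G where "G = {vCons (\<phi> \<bullet> x) (g *\<^sub>v x + l) | x l. x \<in> carrier_vec d \<and> l \<in> U}"
  have "vec_subspace (Suc r) G"
    unfolding vec_subspace_def
  proof (intro conjI ballI allI)
    show "G \<subseteq> carrier_vec (Suc r)" using g UD(5) by (auto simp: G_def)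
    show "0\<^sub>v (Suc r) \<in> G"
      using UD(2) g \<phi>(1) unfolding G_def
      by (intro CollectI exI[of _ "0\<^sub>v d"] exI[of _ "0\<^sub>v r"]) (simp add: mult_mat_zero_vec zero_vec_Suc)
  next
    fix y z assume "y \<in> G" "z \<in> G"
    then obtain x l x' l' where y: "y = vCons (\<phi> \<bullet> x) (g *\<^sub>v x + l)" "x \<in> carrier_vec d" "l \<in> U"
      and z: "z = vCons (\<phi> \<bullet> x') (g *\<^sub>v x' + l')" "x' \<in> carrier_vec d" "l' \<in> U"
      unfolding G_def by blast
    have "y + z = vCons (\<phi> \<bullet> (x + x')) (g *\<^sub>v (x + x') + (l + l'))"
    proof -
      have "g *\<^sub>v x + l + (g *\<^sub>v x' + l') = g *\<^sub>v (x + x') + (l + l')"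
        using g y(2) z(2) UD(5)[OF y(3)] UD(5)[OF z(3)] mult_add_distrib_mat_vec[OF g y(2) z(2)]
        by (intro eq_vecI) auto
      moreover have "dim_vec (g *\<^sub>v x + l) = dim_vec (g *\<^sub>v x' + l')"
        using UD(5)[OF y(3)] UD(5)[OF z(3)] by simp
      ultimately show ?thesis
        using scalar_prod_add_distrib[OF \<phi>(1) y(2) z(2)] by (simp add: y(1) z(1) vCons_add)
    qed
    moreover have "x + x' \<in> carrier_vec d" "l + l' \<in> U" using y z UD(3) by auto
    ultimately show "y + z \<in> G" unfolding G_def by blast
  next
    fix b y assume "y \<in> G"
    then obtain x l where y: "y = vCons (\<phi> \<bullet> x) (g *\<^sub>v x + l)" "x \<in> carrier_vec d" "l \<in> U"
      unfolding G_def by blast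
    have "b \<cdot>\<^sub>v y = vCons (\<phi> \<bullet> (b \<cdot>\<^sub>v x)) (g *\<^sub>v (b \<cdot>\<^sub>v x) + b \<cdot>\<^sub>v l)"
      using g y UD(5)[OF y(3)] \<phi>(1) mult_mat_vec[OF g y(2)]
      by (simp add: vCons_smult smult_add_distrib_vec[of _ r])
    moreover have "b \<cdot>\<^sub>v x \<in> carrier_vec d" "b \<cdot>\<^sub>v l \<in> U" using y UD(4) by auto
    ultimately show "b \<cdot>\<^sub>v y \<in> G" unfolding G_def by blast
  qed
  moreover have "vCons 1 (0\<^sub>v r) \<notin> G"
  proof
    assume "vCons 1 (0\<^sub>v r) \<in> G"
    then obtain x l where x: "\<phi> \<bullet> x = 1" "g *\<^sub>v x + l = 0\<^sub>v r" "x \<in> carrier_vec d" "l \<in> U"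
      unfolding G_def by auto
    have "g *\<^sub>v x = (- 1) \<cdot>\<^sub>v l"
    proof (intro eq_vecI)
      fix i assume "i < dim_vec ((- 1) \<cdot>\<^sub>v l)"
      then have i: "i < r" using UD(5)[OF x(4)] by simp
      then have "(g *\<^sub>v x + l) $ i = 0" using x(2) by simp
      then show "(g *\<^sub>v x) $ i = ((- 1) \<cdot>\<^sub>v l) $ i"
        using i g UD(5)[OF x(4)] by (simp add: eq_neg_iff_add_eq_0)
    qed (use g UD(5)[OF x(4)] in auto)
    then have "\<phi> \<bullet> x = 0" using \<phi>(2)[OF x(3)] UD(4)[OF x(4)] by simp
    then show False using x(1) by simp
  qed
  ultimately obtain \<theta> where \<theta>: "\<theta> \<in> carrier_vec (Suc r)" "\<forall>u\<in>G. \<theta> \<bullet> u = 0" "\<theta> \<bullet> vCons 1 (0\<^sub>v r) = 1"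
    using separating_functional[of "Suc r" G "vCons 1 (0\<^sub>v r)"] by auto
  obtain c \<eta> where c: "\<theta> = vCons c \<eta>" "\<eta> \<in> carrier_vec r" using \<theta>(1) by (rule carrier_vec_SucE)
  have c1: "c = 1" using \<theta>(3) c by simp
  have G0: "\<phi> \<bullet> x + \<eta> \<bullet> (g *\<^sub>v x + l) = 0" if "x \<in> carrier_vec d" "l \<in> U" for x l
  proof -
    have "vCons (\<phi> \<bullet> x) (g *\<^sub>v x + l) \<in> G" using that unfolding G_def by blast
    then show ?thesis using \<theta>(2) c c1 by fastforce
  qed
  \<comment> \<open>In \<open>G0\<close>, taking \<open>x = 0\<close> shows that \<eta> vanishes on
    \<open>U\<close>, and taking \<open>l = 0\<close> that \<phi> is \<open>- \<eta>\<close>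
    composed with \<open>g\<close>.\<close>
  let ?\<psi> = "- \<eta>"
  have "?\<psi> \<bullet> u = 0" if "u \<in> U" for u
    using G0[of "0\<^sub>v d" u] that g \<phi>(1) c(2) UD(5)[OF that] by (simp add: mult_mat_zero_vec)
  moreover have "transpose_mat g *\<^sub>v ?\<psi> = \<phi>"
  proof (intro eq_vecI)
    fix i assume "i < dim_vec \<phi>"
    then have i: "i < d" using \<phi>(1) by simp
    have "(transpose_mat g *\<^sub>v ?\<psi>) $ i = (transpose_mat g *\<^sub>v ?\<psi>) \<bullet> unit_vec d i"
      using g i by simp
    also have "\<dots> = ?\<psi> \<bullet> (g *\<^sub>v unit_vec d i)"
      using g c(2) by (intro transpose_vec_mult_scalar) auto
    also have "\<dots> = \<phi> \<bullet> unit_vec d i"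
      using G0[of "unit_vec d i" "0\<^sub>v r"] UD(2) g c(2)
        minus_unique[of "\<eta> \<bullet> (g *\<^sub>v unit_vec d i)" "\<phi> \<bullet> unit_vec d i"]
      by (simp add: add.commute)
    finally show "(transpose_mat g *\<^sub>v ?\<psi>) $ i = \<phi> $ i" using i by simp
  qed (use g \<phi>(1) in auto)
  ultimately show ?thesis using c(2) by (intro bexI[of _ ?\<psi>]) auto
qed

text \<open>In terms of the interval module \<open>M = M\<^bsub>[i,j]\<^esub>\<close> over the vertices \<open>1, \<dots>, j\<close>: \<open>v\<close> is the value at \<open>j\<close>
  of a morphism \<open>M \<rightarrow> V\<close>, respectively \<open>\<phi>\<close> is the component at \<open>j\<close> of a morphism \<open>V \<rightarrow> M\<close>.\<close>

definition lifts :: "(nat \<Rightarrow> bool) \<Rightarrow> 'k::field rep \<Rightarrow> nat \<Rightarrow> nat \<Rightarrow> 'k vec \<Rightarrow> bool" where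
  "lifts ori V i j v \<longleftrightarrow> (\<exists>u. u j = v \<and> (\<forall>t\<in>{i..j}. u t \<in> carrier_vec (rdim V t)) \<and>
     (\<forall>a\<in>{i..<j}. rmap V a *\<^sub>v u (src ori a) = u (tgt ori a)) \<and>
     (1 < i \<and> \<not> ori (i - 1) \<longrightarrow> rmap V (i - 1) *\<^sub>v u i = 0\<^sub>v (rdim V (i - 1))))"

definition colifts :: "(nat \<Rightarrow> bool) \<Rightarrow> 'k::field rep \<Rightarrow> nat \<Rightarrow> nat \<Rightarrow> 'k vec \<Rightarrow> bool" where
  "colifts ori V i j \<phi> \<longleftrightarrow> (\<exists>w. w j = \<phi> \<and> (\<forall>t\<in>{i..j}. w t \<in> carrier_vec (rdim V t)) \<and>
     (\<forall>a\<in>{i..<j}. transpose_mat (rmap V a) *\<^sub>v w (tgt ori a) = w (src ori a)) \<and>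
     (1 < i \<and> ori (i - 1) \<longrightarrow> transpose_mat (rmap V (i - 1)) *\<^sub>v w i = 0\<^sub>v (rdim V (i - 1))))"

text \<open>A flag is encoded as a path of this relation from 0 to the whole space. Each step offers
  both halves of a retraction onto the interval module: inclusions from the vectors of
  \<open>H\<close>, projections from the functionals that kill \<open>L\<close>.\<close>

definition flag_step :: "(nat \<Rightarrow> bool) \<Rightarrow> 'k::field rep \<Rightarrow> nat \<Rightarrow> 'k vec set \<Rightarrow> 'k vec set \<Rightarrow> bool" where
  "flag_step ori V j L H \<longleftrightarrow> vec_subspace (rdim V j) L \<and> vec_subspace (rdim V j) H \<and>
     (\<exists>i. 1 \<le> i \<and> i \<le> j \<and> (\<forall>v\<in>H. lifts ori V i j v) \<and>
       (\<forall>\<phi>\<in>carrier_vec (rdim V j). (\<forall>u\<in>L. \<phi> \<bullet> u = 0) \<longrightarrow> colifts ori V i j \<phi>))"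

text \<open>For an arrow into the new vertex the new value is forced; for the opposite arrow any
  preimage will do. For \<open>colifts\<close> the transposed maps exchange the two cases.\<close>

lemma lifts_Suc:
  assumes "lifts ori V i j v" "i \<le> j" "v' \<in> carrier_vec (rdim V (Suc j))"
    "if ori j then rmap V j *\<^sub>v v = v' else rmap V j *\<^sub>v v' = v"
  shows "lifts ori V i (Suc j) v'"
proof -
  obtain u where u: "u j = v" "\<forall>t\<in>{i..j}. u t \<in> carrier_vec (rdim V t)"
     "\<forall>a\<in>{i..<j}. rmap V a *\<^sub>v u (src ori a) = u (tgt ori a)"
     "1 < i \<and> \<not> ori (i - 1) \<longrightarrow> rmap V (i - 1) *\<^sub>v u i = 0\<^sub>v (rdim V (i - 1))"
    using assms(1) unfolding lifts_def by blast
  let ?u = "u(Suc j := v')"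
  have "rmap V a *\<^sub>v ?u (src ori a) = ?u (tgt ori a)" if "a \<in> {i..<Suc j}" for a
    using u(1) u(3)[rule_format, of a] that assms(4) by (cases "a = j") (auto simp: src_def tgt_def split: if_splits)
  then show ?thesis
    unfolding lifts_def using u assms(2,3) by (intro exI[of _ ?u]) (auto simp: le_Suc_eq)
qed

lemma colifts_Suc:
  assumes "colifts ori V i j v" "i \<le> j" "v' \<in> carrier_vec (rdim V (Suc j))"
    "if ori j then transpose_mat (rmap V j) *\<^sub>v v' = v else transpose_mat (rmap V j) *\<^sub>v v = v'"
  shows "colifts ori V i (Suc j) v'"
proof -
  obtain u where u: "u j = v" "\<forall>t\<in>{i..j}. u t \<in> carrier_vec (rdim V t)"
     "\<forall>a\<in>{i..<j}. transpose_mat (rmap V a) *\<^sub>v u (tgt ori a) = u (src ori a)"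
     "1 < i \<and> ori (i - 1) \<longrightarrow> transpose_mat (rmap V (i - 1)) *\<^sub>v u i = 0\<^sub>v (rdim V (i - 1))"
    using assms(1) unfolding colifts_def by blast
  let ?u = "u(Suc j := v')"
  have "transpose_mat (rmap V a) *\<^sub>v ?u (tgt ori a) = ?u (src ori a)" if "a \<in> {i..<Suc j}" for a
    using u(1) u(3)[rule_format, of a] that assms(4) by (cases "a = j") (auto simp: src_def tgt_def split: if_splits)
  then show ?thesis
    unfolding colifts_def using u assms(2,3) by (intro exI[of _ ?u]) (auto simp: le_Suc_eq)
qed

lemma lifts_refl:
  assumes "v \<in> carrier_vec (rdim V j)" "1 < j \<Longrightarrow> \<not> ori (j - 1) \<Longrightarrow> rmap V (j - 1) *\<^sub>v v = 0\<^sub>v (rdim V (j - 1))"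
  shows "lifts ori V j j v"
  unfolding lifts_def using assms by (intro exI[of _ "\<lambda>_. v"]) auto

lemma colifts_refl:
  assumes "v \<in> carrier_vec (rdim V j)"
    "1 < j \<Longrightarrow> ori (j - 1) \<Longrightarrow> transpose_mat (rmap V (j - 1)) *\<^sub>v v = 0\<^sub>v (rdim V (j - 1))"
  shows "colifts ori V j j v"
  unfolding colifts_def using assms by (intro exI[of _ "\<lambda>_. v"]) auto

section \<open>Transport of flags along an arrow\<close>

lemma vec_subspace_zero: "vec_subspace d {0\<^sub>v d}"
  by (auto simp: vec_subspace_def)

lemma vec_subspace_carrier: "vec_subspace d (carrier_vec d)"
  by (auto simp: vec_subspace_def)

lemma vec_subspace_image:
  assumes f: "f \<in> carrier_mat r d" and U: "vec_subspace d U"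
  shows "vec_subspace r ((*\<^sub>v) f ` U)"
  unfolding vec_subspace_def
proof (intro conjI ballI allI)
  note UD = vec_subspaceD[OF U]
  show "(*\<^sub>v) f ` U \<subseteq> carrier_vec r" using f UD(5) by auto
  show "0\<^sub>v r \<in> (*\<^sub>v) f ` U" using UD(2) mult_mat_zero_vec[OF f] by (metis imageI)
  show "y + z \<in> (*\<^sub>v) f ` U" if y: "y \<in> (*\<^sub>v) f ` U" and z: "z \<in> (*\<^sub>v) f ` U" for y z
  proof -
    obtain a b where "y = f *\<^sub>v a" "z = f *\<^sub>v b" "a \<in> U" "b \<in> U" using y z by blast
    then show ?thesis using mult_add_distrib_mat_vec[OF f UD(5) UD(5), of a b] UD(3)[of a b] by (metis imageI)
  qed
  show "c \<cdot>\<^sub>v y \<in> (*\<^sub>v) f ` U" if y: "y \<in> (*\<^sub>v) f ` U" for c y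
  proof -
    obtain a where "y = f *\<^sub>v a" "a \<in> U" using y by blast
    then show ?thesis using mult_mat_vec[OF f UD(5), of a c] UD(4)[of a c] by (metis imageI)
  qed
qed

lemma vec_subspace_vimage:
  assumes f: "f \<in> carrier_mat r d" and U: "vec_subspace r U"
  shows "vec_subspace d {x \<in> carrier_vec d. f *\<^sub>v x \<in> U}"
  unfolding vec_subspace_def
  using vec_subspaceD[OF U] mult_mat_zero_vec[OF f] mult_add_distrib_mat_vec[OF f] mult_mat_vec[OF f]
  by auto

text \<open>A functional that kills the image of \<open>L\<close> pulls back to one that kills
  \<open>L\<close>.\<close>

lemma flag_step_image:
  assumes V: "is_rep n ori V" and j: "1 \<le> j" "j < n" "ori j" and s: "flag_step ori V j L H"
  shows "flag_step ori V (Suc j) ((*\<^sub>v) (rmap V j) ` L) ((*\<^sub>v) (rmap V j) ` H)"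
proof -
  let ?f = "rmap V j"
  have f: "?f \<in> carrier_mat (rdim V (Suc j)) (rdim V j)"
    using rmap_carrier[OF V, of j] j by (simp add: src_def tgt_def)
  obtain i where i: "1 \<le> i" "i \<le> j" "\<forall>v\<in>H. lifts ori V i j v"
    "\<forall>\<phi>\<in>carrier_vec (rdim V j). (\<forall>u\<in>L. \<phi> \<bullet> u = 0) \<longrightarrow> colifts ori V i j \<phi>"
    and sub: "vec_subspace (rdim V j) L" "vec_subspace (rdim V j) H"
    using s unfolding flag_step_def by blast
  have "lifts ori V i (Suc j) (?f *\<^sub>v v)" if "v \<in> H" for v
    using i j f that vec_subspaceD(5)[OF sub(2) that] by (intro lifts_Suc[of ori V i j v]) auto
  moreover have "colifts ori V i (Suc j) \<phi>"
    if \<phi>: "\<phi> \<in> carrier_vec (rdim V (Suc j))" "\<forall>u\<in>(*\<^sub>v) ?f ` L. \<phi> \<bullet> u = 0" for \<phi>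
  proof -
    have "(transpose_mat ?f *\<^sub>v \<phi>) \<bullet> u = 0" if "u \<in> L" for u
      using transpose_vec_mult_scalar[OF f vec_subspaceD(5)[OF sub(1) that] \<phi>(1)] \<phi>(2) that by simp
    moreover have "transpose_mat ?f *\<^sub>v \<phi> \<in> carrier_vec (rdim V j)" using f by (intro carrier_vecI) simp
    ultimately have "colifts ori V i j (transpose_mat ?f *\<^sub>v \<phi>)" using i(4) by blast
    then show ?thesis using colifts_Suc[of ori V i j _ \<phi>] i j \<phi>(1) by simp
  qed
  ultimately show ?thesis
    unfolding flag_step_def using i sub vec_subspace_image[OF f] by (intro conjI exI[of _ i]) auto
qed

text \<open>Functionals now have to be pushed forward: by \<open>functional_factors\<close>, one
  that kills the preimage of \<open>L\<close> comes from one that kills \<open>L\<close>.\<close>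

lemma flag_step_vimage:
  assumes V: "is_rep n ori V" and j: "1 \<le> j" "j < n" "\<not> ori j" and s: "flag_step ori V j L H"
  shows "flag_step ori V (Suc j) {x \<in> carrier_vec (rdim V (Suc j)). rmap V j *\<^sub>v x \<in> L}
    {x \<in> carrier_vec (rdim V (Suc j)). rmap V j *\<^sub>v x \<in> H}"
proof -
  let ?f = "rmap V j"
  have f: "?f \<in> carrier_mat (rdim V j) (rdim V (Suc j))"
    using rmap_carrier[OF V, of j] j by (simp add: src_def tgt_def)
  obtain i where i: "1 \<le> i" "i \<le> j" "\<forall>v\<in>H. lifts ori V i j v"
    "\<forall>\<phi>\<in>carrier_vec (rdim V j). (\<forall>u\<in>L. \<phi> \<bullet> u = 0) \<longrightarrow> colifts ori V i j \<phi>"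
    and sub: "vec_subspace (rdim V j) L" "vec_subspace (rdim V j) H"
    using s unfolding flag_step_def by blast
  have "lifts ori V i (Suc j) v" if "v \<in> carrier_vec (rdim V (Suc j))" "?f *\<^sub>v v \<in> H" for v
    using i j f that by (intro lifts_Suc[of ori V i j "?f *\<^sub>v v"]) auto
  moreover have "colifts ori V i (Suc j) \<phi>"
    if \<phi>: "\<phi> \<in> carrier_vec (rdim V (Suc j))" "\<forall>u\<in>{x \<in> carrier_vec (rdim V (Suc j)). ?f *\<^sub>v x \<in> L}. \<phi> \<bullet> u = 0" for \<phi>
  proof -
    obtain \<psi> where \<psi>: "\<psi> \<in> carrier_vec (rdim V j)" "\<forall>u\<in>L. \<psi> \<bullet> u = 0" "transpose_mat ?f *\<^sub>v \<psi> = \<phi>"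
      using functional_factors[OF f sub(1) \<phi>(1)] \<phi>(2) by blast
    then show ?thesis using colifts_Suc[of ori V i j \<psi> \<phi>] i j \<phi>(1) by simp
  qed
  ultimately show ?thesis
    unfolding flag_step_def using i sub vec_subspace_vimage[OF f] by (intro conjI exI[of _ i]) auto
qed

lemma rtranclp_map:
  assumes "r\<^sup>*\<^sup>* a b" "\<And>x y. r x y \<Longrightarrow> s (f x) (f y)"
  shows "s\<^sup>*\<^sup>* (f a) (f b)"
  using assms(1) by induction (auto intro: rtranclp.rtrancl_into_rtrancl assms(2))

text \<open>The transported flag lacks one step, which belongs to the intervals starting at the new
  vertex. If the arrow enters it, this step leads from the image to the whole space; if the arrow
  leaves it, from 0 to the kernel.\<close>

lemma flag_exists:
  assumes V: "is_rep n ori V" and j: "1 \<le> j" "j \<le> n"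
  shows "(flag_step ori V j)\<^sup>*\<^sup>* {0\<^sub>v (rdim V j)} (carrier_vec (rdim V j))"
  using j
proof (induction j rule: nat_induct_at_least)
  case base
  have "flag_step ori V 1 {0\<^sub>v (rdim V 1)} (carrier_vec (rdim V 1))"
    unfolding flag_step_def
    by (intro conjI exI[of _ 1] vec_subspace_zero vec_subspace_carrier ballI impI lifts_refl colifts_refl) auto
  then show ?case by simp
next
  case (Suc j)
  let ?f = "rmap V j"
  have IH: "(flag_step ori V j)\<^sup>*\<^sup>* {0\<^sub>v (rdim V j)} (carrier_vec (rdim V j))" using Suc by simp
  have fc: "?f \<in> carrier_mat (rdim V (tgt ori j)) (rdim V (src ori j))"
    using rmap_carrier[OF V, of j] Suc by simp
  show ?case
  proof (cases "ori j")
    case True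
    have f: "?f \<in> carrier_mat (rdim V (Suc j)) (rdim V j)" using fc True by (simp add: src_def tgt_def)
    have "(flag_step ori V (Suc j))\<^sup>*\<^sup>* ((*\<^sub>v) ?f ` {0\<^sub>v (rdim V j)}) ((*\<^sub>v) ?f ` carrier_vec (rdim V j))"
      using Suc.prems Suc.hyps True by (intro rtranclp_map[OF IH] flag_step_image[OF V]) auto
    moreover have "(*\<^sub>v) ?f ` {0\<^sub>v (rdim V j)} = {0\<^sub>v (rdim V (Suc j))}"
      using mult_mat_zero_vec[OF f] by simp
    moreover have "flag_step ori V (Suc j) ((*\<^sub>v) ?f ` carrier_vec (rdim V j)) (carrier_vec (rdim V (Suc j)))"
      unfolding flag_step_def
    proof (intro conjI exI[of _ "Suc j"] ballI impI vec_subspace_carrier vec_subspace_image[OF f])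
      fix \<phi> assume \<phi>: "\<phi> \<in> carrier_vec (rdim V (Suc j))" "\<forall>u\<in>(*\<^sub>v) ?f ` carrier_vec (rdim V j). \<phi> \<bullet> u = 0"
      have "transpose_mat ?f *\<^sub>v \<phi> = 0\<^sub>v (rdim V j)"
      proof (intro eq_vecI)
        fix i assume "i < dim_vec (0\<^sub>v (rdim V j) :: 'a vec)"
        then have i: "i < rdim V j" by simp
        have "(transpose_mat ?f *\<^sub>v \<phi>) $ i = (transpose_mat ?f *\<^sub>v \<phi>) \<bullet> unit_vec (rdim V j) i"
          using f i by simp
        also have "\<dots> = \<phi> \<bullet> (?f *\<^sub>v unit_vec (rdim V j) i)"
          using f \<phi>(1) by (intro transpose_vec_mult_scalar) auto
        also have "\<dots> = 0" using \<phi>(2) by simp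
        finally show "(transpose_mat ?f *\<^sub>v \<phi>) $ i = 0\<^sub>v (rdim V j) $ i" using i by simp
      qed (use f in auto)
      then show "colifts ori V (Suc j) (Suc j) \<phi>" using \<phi>(1) by (intro colifts_refl) auto
    qed (use True in \<open>auto intro: lifts_refl\<close>)
    ultimately show ?thesis by (metis rtranclp.rtrancl_into_rtrancl)
  next
    case False
    have f: "?f \<in> carrier_mat (rdim V j) (rdim V (Suc j))" using fc False by (simp add: src_def tgt_def)
    let ?v = "\<lambda>U. {x \<in> carrier_vec (rdim V (Suc j)). ?f *\<^sub>v x \<in> U}"
    have "(flag_step ori V (Suc j))\<^sup>*\<^sup>* (?v {0\<^sub>v (rdim V j)}) (?v (carrier_vec (rdim V j)))"
      using Suc.prems Suc.hyps False by (intro rtranclp_map[OF IH, of _ ?v] flag_step_vimage[OF V]) auto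
    moreover have "?v (carrier_vec (rdim V j)) = carrier_vec (rdim V (Suc j))"
      using f by auto
    moreover have "flag_step ori V (Suc j) {0\<^sub>v (rdim V (Suc j))} (?v {0\<^sub>v (rdim V j)})"
      unfolding flag_step_def
    proof (intro conjI exI[of _ "Suc j"] ballI impI vec_subspace_zero vec_subspace_vimage[OF f])
      show "lifts ori V (Suc j) (Suc j) v" if "v \<in> ?v {0\<^sub>v (rdim V j)}" for v
        using that by (intro lifts_refl) auto
      show "colifts ori V (Suc j) (Suc j) \<phi>" if "\<phi> \<in> carrier_vec (rdim V (Suc j))" for \<phi>
        using that False by (intro colifts_refl) auto
    qed auto
    ultimately show ?thesis by (metis converse_rtranclp_into_rtranclp)
  qed
qed

lemma rtranclp_crossing:
  assumes "r\<^sup>*\<^sup>* a b" "\<not> P a" "P b"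
  shows "\<exists>x y. r x y \<and> \<not> P x \<and> P y"
  using assms by induction auto

text \<open>The step at which the flag leaves 0 is enough: its lower member is zero, so every
  functional is admissible, in particular one with value 1 at a nonzero vector of the upper
  member.\<close>

lemma thin_retract_exists:
  fixes V :: "'k::field rep"
  assumes V: "is_rep n ori V" and j: "1 \<le> j" "j \<le> n" "rdim V j \<noteq> 0"
  shows "\<exists>i v \<phi>. 1 \<le> i \<and> i \<le> j \<and> lifts ori V i j v \<and> colifts ori V i j \<phi> \<and> \<phi> \<bullet> v = 1"
proof -
  let ?d = "rdim V j"
  have "unit_vec ?d 0 \<in> carrier_vec ?d" "unit_vec ?d 0 \<noteq> (0\<^sub>v ?d :: 'k vec)" using j(3) by auto
  then have "\<not> carrier_vec ?d \<subseteq> {0\<^sub>v ?d :: 'k vec}" by blast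
  then obtain L H where LH: "flag_step ori V j L H" "L \<subseteq> {0\<^sub>v ?d}" "\<not> H \<subseteq> {0\<^sub>v ?d}"
    using rtranclp_crossing[OF flag_exists[OF V j(1,2)], of "\<lambda>U. \<not> U \<subseteq> {0\<^sub>v ?d}"] by auto
  obtain i where i: "1 \<le> i" "i \<le> j" "\<forall>v\<in>H. lifts ori V i j v"
    "\<forall>\<phi>\<in>carrier_vec ?d. (\<forall>u\<in>L. \<phi> \<bullet> u = 0) \<longrightarrow> colifts ori V i j \<phi>" "vec_subspace ?d H"
    using LH(1) unfolding flag_step_def by blast
  obtain v where v: "v \<in> H" "v \<noteq> 0\<^sub>v ?d" using LH(3) by blast
  have vc: "v \<in> carrier_vec ?d" using vec_subspaceD(5)[OF i(5) v(1)] .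
  obtain \<phi> where \<phi>: "\<phi> \<in> carrier_vec ?d" "\<phi> \<bullet> v = 1"
    using separating_functional[OF vec_subspace_zero vc] v(2) by blast
  have "\<forall>u\<in>L. \<phi> \<bullet> u = 0" using LH(2) \<phi>(1) by auto
  then show ?thesis using i v \<phi> by blast
qed

section \<open>Splitting off a thin direct summand\<close>

lemma adapted_basis:
  fixes v \<phi> :: "'k::field vec"
  assumes v: "v \<in> carrier_vec d" and \<phi>: "\<phi> \<in> carrier_vec d" and one: "\<phi> \<bullet> v = 1"
  shows "\<exists>g h. g \<in> carrier_mat d d \<and> h \<in> carrier_mat d d \<and> g * h = 1\<^sub>m d \<and> h * g = 1\<^sub>m d \<and>
    0 < d \<and> row g 0 = \<phi> \<and> col h 0 = v"
proof -
  have "\<exists>p<d. \<phi> $ p \<noteq> 0"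
  proof (rule ccontr)
    assume "\<not> ?thesis"
    then have "\<phi> = 0\<^sub>v d" using \<phi> by (intro eq_vecI) auto
    then show False using one v by simp
  qed
  then obtain p where p: "p < d" "\<phi> $ p \<noteq> 0" by blast
  \<comment> \<open>Index 0 is reserved for \<open>v\<close> and \<phi>; exchanging 0 and
    \<open>p\<close> lets the other indices run through the coordinates different from
    \<open>p\<close>.\<close>
  define \<sigma> where "\<sigma> c = (if c = 0 then p else if c = p then 0 else c)" for c :: nat
  have \<sigma>: "\<sigma> c < d" "\<sigma> c = \<sigma> c' \<longleftrightarrow> c = c'" "0 < c \<Longrightarrow> \<sigma> c \<noteq> p" if "c < d" for c c'
    using that p(1) by (auto simp: \<sigma>_def)
  \<comment> \<open>The columns are \<open>v\<close> and the basis
    \<open>e_k - (\<phi>_k / \<phi>_p) e_p\<close> of the kernel of \<phi>, for \<open>k\<close>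
    different from \<open>p\<close>. The rows are the dual basis, \<phi> and
    \<open>e_k* - v_k \<phi>\<close>.\<close>
  let ?r = "\<lambda>c. if c = 0 then \<phi> else unit_vec d (\<sigma> c) - (v $ \<sigma> c) \<cdot>\<^sub>v \<phi>"
  let ?c = "\<lambda>c. if c = 0 then v else unit_vec d (\<sigma> c) - (\<phi> $ \<sigma> c / \<phi> $ p) \<cdot>\<^sub>v unit_vec d p"
  let ?g = "mat d d (\<lambda>(i, k). ?r i $ k)" and ?h = "mat d d (\<lambda>(i, k). ?c k $ i)"
  have rc: "?r c \<in> carrier_vec d" "?c c \<in> carrier_vec d" for c using v \<phi> by auto
  have g: "row ?g c = ?r c" if "c < d" for c using v \<phi> that by (intro eq_vecI) auto
  have h: "col ?h c = ?c c" if "c < d" for c using v \<phi> that by (intro eq_vecI) auto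
  have \<phi>c: "\<phi> \<bullet> ?c c = 0" if "c < d" "0 < c" for c
    using that \<phi> p \<sigma>[OF that(1)] by (simp add: scalar_prod_minus_distrib[of _ d])
  have rc': "?r c \<bullet> ?c c' = (if c = c' then 1 else 0)" if "c < d" "c' < d" for c c'
  proof (cases "c = 0")
    case True
    then show ?thesis using \<phi>c[of c'] that one by auto
  next
    case False
    have "?r c \<bullet> ?c c' = unit_vec d (\<sigma> c) \<bullet> ?c c' - (v $ \<sigma> c) * (\<phi> \<bullet> ?c c')"
      using False rc(2)[of c'] \<phi> by (simp only: if_False minus_scalar_prod_distrib[of _ d] unit_vec_carrier smult_carrier_vec smult_scalar_prod_distrib[of _ d])
    also have "unit_vec d (\<sigma> c) \<bullet> ?c c' = ?c c' $ \<sigma> c"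
      using rc(2)[of c'] \<sigma>(1)[OF that(1)] by (rule scalar_prod_left_unit)
    finally show ?thesis
      using False \<phi>c[of c'] that one \<sigma>[OF that(1)] \<sigma>[OF that(2)] p(1) by (cases "c' = 0") auto
  qed
  have gh: "?g * ?h = 1\<^sub>m d"
    by (intro eq_matI) (simp_all add: g h rc' del: row_mat col_mat)
  moreover have "?h * ?g = 1\<^sub>m d" by (rule mat_mult_left_right_inverse[OF _ _ gh]) auto
  moreover have "0 < d" using p by simp
  ultimately show ?thesis using g[of 0] h[of 0] by (intro exI[of _ ?g] exI[of _ ?h]) auto
qed

lemma invertible_matI:
  assumes "g \<in> carrier_mat d d" "h \<in> carrier_mat d d" "g * h = 1\<^sub>m d" "h * g = 1\<^sub>m d"
  shows "invertible_mat g"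
  using assms unfolding invertible_mat_def inverts_mat_def by (auto intro!: exI[of _ h])

text \<open>In bases adapted to \<open>u t\<close> and \<open>w t\<close>, the conditions on
  \<open>u\<close> fix the first columns of the maps and those on \<open>w\<close> the first rows.
  The maps become block diagonal, and \<open>W\<close> is the complementary block.\<close>

lemma thin_summand:
  fixes V :: "'k::field rep"
  assumes V: "is_rep n ori V" and S: "S \<subseteq> {1..n}"
    and c: "\<And>t. t \<in> S \<Longrightarrow> u t \<in> carrier_vec (rdim V t)" "\<And>t. t \<in> S \<Longrightarrow> w t \<in> carrier_vec (rdim V t)"
    and one: "\<And>t. t \<in> S \<Longrightarrow> w t \<bullet> u t = 1"
    and u: "\<And>a. a \<in> {1..<n} \<Longrightarrow> src ori a \<in> S \<Longrightarrow>
      rmap V a *\<^sub>v u (src ori a) = (if tgt ori a \<in> S then u (tgt ori a) else 0\<^sub>v (rdim V (tgt ori a)))"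
    and w: "\<And>a. a \<in> {1..<n} \<Longrightarrow> tgt ori a \<in> S \<Longrightarrow>
      transpose_mat (rmap V a) *\<^sub>v w (tgt ori a) = (if src ori a \<in> S then w (src ori a) else 0\<^sub>v (rdim V (src ori a)))"
  shows "\<exists>W. is_rep n ori W \<and> rep_iso n ori V (rep_dsum ori (thin_rep ori S) W)"
proof -
  let ?d = "rdim V"
  have "\<forall>t. \<exists>g h. g \<in> carrier_mat (?d t) (?d t) \<and> h \<in> carrier_mat (?d t) (?d t) \<and>
      g * h = 1\<^sub>m (?d t) \<and> h * g = 1\<^sub>m (?d t) \<and> (t \<in> S \<longrightarrow> 0 < ?d t \<and> row g 0 = w t \<and> col h 0 = u t)"
  proof
    fix t
    show "\<exists>g h. g \<in> carrier_mat (?d t) (?d t) \<and> h \<in> carrier_mat (?d t) (?d t) \<and>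
      g * h = 1\<^sub>m (?d t) \<and> h * g = 1\<^sub>m (?d t) \<and> (t \<in> S \<longrightarrow> 0 < ?d t \<and> row g 0 = w t \<and> col h 0 = u t)"
    proof (cases "t \<in> S")
      case True
      then show ?thesis using adapted_basis[OF c one] by blast
    next
      case False
      then show ?thesis by (intro exI[of _ "1\<^sub>m (?d t)"]) auto
    qed
  qed
  then obtain g h where gh: "\<And>t. g t \<in> carrier_mat (?d t) (?d t)" "\<And>t. h t \<in> carrier_mat (?d t) (?d t)"
      "\<And>t. g t * h t = 1\<^sub>m (?d t)" "\<And>t. h t * g t = 1\<^sub>m (?d t)"
      "\<And>t. t \<in> S \<Longrightarrow> 0 < ?d t \<and> row (g t) 0 = w t \<and> col (h t) 0 = u t"
    by metis
  \<comment> \<open>The size of the thin block at \<open>t\<close>, by which the indices of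
    \<open>W\<close> are shifted; outside \<open>S\<close> the whole space goes to
    \<open>W\<close>.\<close>
  define \<delta> where "\<delta> t = (if t \<in> S then 1 else 0 :: nat)" for t
  define N where "N a = g (tgt ori a) * (rmap V a * h (src ori a))" for a
  define W where "W = \<lparr> rdim = (\<lambda>t. ?d t - \<delta> t),
    rmap = (\<lambda>a. mat (?d (tgt ori a) - \<delta> (tgt ori a)) (?d (src ori a) - \<delta> (src ori a))
      (\<lambda>(r, c). N a $$ (r + \<delta> (tgt ori a), c + \<delta> (src ori a)))) \<rparr>"
  \<comment> \<open>The dimensions of \<open>W\<close> are truncated differences, so this makes them
    add up correctly.\<close>
  have \<delta>: "\<delta> t \<le> ?d t" for t using gh(5)[of t] by (auto simp: \<delta>_def)
  have W: "is_rep n ori W" using V by (auto simp: is_rep_def W_def)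
  have dim: "rdim (rep_dsum ori (thin_rep ori S) W) t = ?d t" for t
    using \<delta>[of t] by (simp add: rdim_rep_dsum rdim_thin_rep W_def \<delta>_def split: if_splits)
  have main: "rmap (rep_dsum ori (thin_rep ori S) W) a = N a" if a: "a \<in> {1..<n}" for a
  proof -
    let ?s = "src ori a" and ?t = "tgt ori a"
    have f: "rmap V a \<in> carrier_mat (?d ?t) (?d ?s)" by (rule rmap_carrier[OF V a])
    have fh: "rmap V a * h ?s \<in> carrier_mat (?d ?t) (?d ?s)" using f gh(2) by (rule mult_carrier_mat)
    have Nc: "N a \<in> carrier_mat (?d ?t) (?d ?s)" unfolding N_def using gh(1) fh by (rule mult_carrier_mat)
    have N: "N a $$ (r, c) = row (g ?t) r \<bullet> (rmap V a *\<^sub>v col (h ?s) c)" if "r < ?d ?t" "c < ?d ?s" for r c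
    proof -
      have "N a $$ (r, c) = row (g ?t) r \<bullet> col (rmap V a * h ?s) c"
        unfolding N_def using that carrier_matD[OF fh] carrier_matD[OF gh(1)[of ?t]]
        by (intro index_mult_mat) simp_all
      then show ?thesis using col_mult2[OF f gh(2) that(2)] by simp
    qed
    have gu: "row (g t) r \<bullet> u t = (if r = 0 then 1 else 0)" if "t \<in> S" "r < ?d t" for t r
    proof -
      have "row (g t) r \<bullet> col (h t) 0 = (g t * h t) $$ (r, 0)"
        using that carrier_matD[OF gh(1)[of t]] carrier_matD[OF gh(2)[of t]] gh(5)[OF that(1)]
        by (intro index_mult_mat(1)[symmetric]) simp_all
      then show ?thesis using gh(3)[of t] gh(5)[OF that(1)] that by simp
    qed
    have wh: "w t \<bullet> col (h t) c = (if c = 0 then 1 else 0)" if "t \<in> S" "c < ?d t" for t c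
    proof -
      have "row (g t) 0 \<bullet> col (h t) c = (g t * h t) $$ (0, c)"
        using that carrier_matD[OF gh(1)[of t]] carrier_matD[OF gh(2)[of t]] gh(5)[OF that(1)]
        by (intro index_mult_mat(1)[symmetric]) simp_all
      then show ?thesis using gh(3)[of t] gh(5)[OF that(1)] that by simp
    qed
    have col0: "N a $$ (r, 0) = (if ?t \<in> S \<and> r = 0 then 1 else 0)" if "?s \<in> S" "r < ?d ?t" for r
    proof -
      have "N a $$ (r, 0) = row (g ?t) r \<bullet> (rmap V a *\<^sub>v u ?s)"
        using N[of r 0] that gh(5)[OF that(1)] by simp
      then show ?thesis
        using u[OF a that(1)] gu[of ?t r] that gh(1)[of ?t] by (auto simp: row_carrier_vec)
    qed
    have row0: "N a $$ (0, c) = (if ?s \<in> S \<and> c = 0 then 1 else 0)" if "?t \<in> S" "c < ?d ?s" for c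
    proof -
      have hc: "col (h ?s) c \<in> carrier_vec (?d ?s)" using gh(2)[of ?s] by (metis carrier_matD(1) col_dim)
      have "N a $$ (0, c) = w ?t \<bullet> (rmap V a *\<^sub>v col (h ?s) c)"
        using N[of 0 c] that gh(5)[OF that(1)] by simp
      also have "\<dots> = (transpose_mat (rmap V a) *\<^sub>v w ?t) \<bullet> col (h ?s) c"
        by (rule transpose_vec_mult_scalar[symmetric, OF f hc c(2)[OF that(1)]])
      finally show ?thesis
        using w[OF a that(1)] wh[of ?s c] that hc by auto
    qed
    show ?thesis
    proof (rule eq_matI)
      fix r c assume "r < dim_row (N a)" "c < dim_col (N a)"
      then have rc: "r < ?d ?t" "c < ?d ?s" using Nc by auto
      then show "rmap (rep_dsum ori (thin_rep ori S) W) a $$ (r, c) = N a $$ (r, c)"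
        using col0[of r] row0[of c] \<delta>[of ?s] \<delta>[of ?t]
        by (cases "r = 0"; cases "c = 0"; cases "?s \<in> S"; cases "?t \<in> S")
          (simp_all add: rep_dsum_def thin_rep_def W_def \<delta>_def)
    qed (use Nc \<delta>[of ?s] \<delta>[of ?t] in \<open>auto simp: rep_dsum_def thin_rep_def W_def \<delta>_def\<close>)
  qed
  have "rep_iso n ori V (rep_dsum ori (thin_rep ori S) W)"
    unfolding rep_iso_def
  proof (intro exI[of _ g] conjI ballI)
    fix t
    show "g t \<in> carrier_mat (rdim (rep_dsum ori (thin_rep ori S) W) t) (?d t)"
      unfolding dim by (rule gh(1))
    show "invertible_mat (g t)" using gh(1-4) by (rule invertible_matI)
  next
    fix a assume a: "a \<in> {1..<n}"
    let ?s = "src ori a" and ?t = "tgt ori a"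
    have f: "rmap V a \<in> carrier_mat (?d ?t) (?d ?s)" by (rule rmap_carrier[OF V a])
    have "N a * g ?s = g ?t * (rmap V a * h ?s * g ?s)"
      unfolding N_def using gh(1)[of ?t] mult_carrier_mat[OF f gh(2)[of ?s]] gh(1)[of ?s] by (rule assoc_mult_mat)
    also have "rmap V a * h ?s * g ?s = rmap V a * (h ?s * g ?s)"
      using f gh(2)[of ?s] gh(1)[of ?s] by (rule assoc_mult_mat)
    also have "\<dots> = rmap V a" using gh(4)[of ?s] f by simp
    finally show "g ?t * rmap V a = rmap (rep_dsum ori (thin_rep ori S) W) a * g ?s"
      unfolding main[OF a] by simp
  qed
  then show ?thesis using W by blast
qed

lemma indecomposable_dimvec:
  fixes V :: "'k::field rep"
  assumes "indecomposable n ori V"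
  shows "dimvec V \<in> pos_roots n"
proof -
  have V: "is_rep n ori V" "rep_nonzero V" using assms by (auto simp: indecomposable_def)
  let ?d = "rdim V"
  let ?A = "{t. ?d t \<noteq> 0}"
  have A: "?A \<subseteq> {1..n}" "?A \<noteq> {}" using V by (auto simp: is_rep_def rep_nonzero_def)
  then have fin: "finite ?A" using finite_subset by blast
  define j where "j = Max ?A"
  have "j \<in> ?A" unfolding j_def using fin A(2) by (rule Max_in)
  then have j: "1 \<le> j" "j \<le> n" "?d j \<noteq> 0" using A(1) by auto
  \<comment> \<open>Hence the arrow at \<open>j\<close> imposes no condition, and morphisms over the
    vertices up to \<open>j\<close> are morphisms over the whole quiver.\<close>
  have zero: "?d (Suc j) = 0"
  proof (rule ccontr)
    assume "?d (Suc j) \<noteq> 0"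
    then have "Suc j \<le> j" unfolding j_def using fin by (intro Max_ge) auto
    then show False by simp
  qed
  obtain i v \<phi> where i: "1 \<le> i" "i \<le> j" and lift: "lifts ori V i j v" "colifts ori V i j \<phi>" and one: "\<phi> \<bullet> v = 1"
    using thin_retract_exists[OF V(1) j] by blast
  obtain u where u: "u j = v" "\<forall>t\<in>{i..j}. u t \<in> carrier_vec (?d t)"
     "\<forall>a\<in>{i..<j}. rmap V a *\<^sub>v u (src ori a) = u (tgt ori a)"
     "1 < i \<and> \<not> ori (i - 1) \<longrightarrow> rmap V (i - 1) *\<^sub>v u i = 0\<^sub>v (?d (i - 1))"
    using lift(1) unfolding lifts_def by blast
  obtain w where w: "w j = \<phi>" "\<forall>t\<in>{i..j}. w t \<in> carrier_vec (?d t)"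
     "\<forall>a\<in>{i..<j}. transpose_mat (rmap V a) *\<^sub>v w (tgt ori a) = w (src ori a)"
     "1 < i \<and> ori (i - 1) \<longrightarrow> transpose_mat (rmap V (i - 1)) *\<^sub>v w i = 0\<^sub>v (?d (i - 1))"
    using lift(2) unfolding colifts_def by blast
  \<comment> \<open>Moving the map across the pairing by transposition shows that the composite is
    constant along the interval, so its value 1 at \<open>j\<close> spreads to every vertex.\<close>
  have st: "w (tgt ori a) \<bullet> u (tgt ori a) = w (src ori a) \<bullet> u (src ori a)" if a: "a \<in> {i..<j}" for a
  proof -
    have "a \<in> {1..<n}" using a i j by auto
    then have f: "rmap V a \<in> carrier_mat (?d (tgt ori a)) (?d (src ori a))" using rmap_carrier[OF V(1)] by blast
    have "src ori a \<in> {i..j}" "tgt ori a \<in> {i..j}" using a by (auto simp: src_def tgt_def)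
    then show ?thesis
      using transpose_vec_mult_scalar[OF f, of "u (src ori a)" "w (tgt ori a)"] u(2,3) w(2,3) a by simp
  qed
  have st': "w a \<bullet> u a = w (Suc a) \<bullet> u (Suc a)" if "a \<in> {i..<j}" for a
    using st[OF that] by (auto simp: src_def tgt_def split: if_splits)
  have ones: "w t \<bullet> u t = 1" if "t \<in> {i..j}" for t
  proof -
    have "t \<le> j" "i \<le> t" using that by auto
    then show ?thesis
      by (induction rule: inc_induct) (use one u(1) w(1) st' in auto)
  qed
  have "\<exists>W. is_rep n ori W \<and> rep_iso n ori V (rep_dsum ori (thin_rep ori {i..j}) W)"
  proof (rule thin_summand[OF V(1), of _ u w])
    show "{i..j} \<subseteq> {1..n}" using i j by auto
    fix a assume a: "a \<in> {1..<n}"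
    have f: "rmap V a \<in> carrier_mat (?d (tgt ori a)) (?d (src ori a))" using rmap_carrier[OF V(1) a] .
    have *: "a \<in> {i..<j} \<or> (a = j \<and> (if ori a then src ori a = j \<and> tgt ori a = Suc j else src ori a = Suc j \<and> tgt ori a = j)) \<or>
        (a = i - 1 \<and> 1 < i \<and> (if ori a then src ori a = i - 1 \<and> tgt ori a = i else src ori a = i \<and> tgt ori a = i - 1))"
      if "src ori a \<in> {i..j} \<or> tgt ori a \<in> {i..j}"
      using that a by (auto simp: src_def tgt_def split: if_splits)
    have z: "x = 0\<^sub>v (?d t)" if "x \<in> carrier_vec (?d t)" "t = Suc j" for x :: "'k vec" and t
      using that zero by auto
    show "rmap V a *\<^sub>v u (src ori a) = (if tgt ori a \<in> {i..j} then u (tgt ori a) else 0\<^sub>v (?d (tgt ori a)))"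
      if "src ori a \<in> {i..j}"
    proof -
      have "rmap V a *\<^sub>v u (src ori a) \<in> carrier_vec (?d (tgt ori a))" using f by (intro carrier_vecI) simp
      then show ?thesis
        using *[OF disjI1[OF that]] that u(3,4) z[of "rmap V a *\<^sub>v u (src ori a)" "tgt ori a"]
        by (auto simp: src_def tgt_def split: if_splits)
    qed
    show "transpose_mat (rmap V a) *\<^sub>v w (tgt ori a) = (if src ori a \<in> {i..j} then w (src ori a) else 0\<^sub>v (?d (src ori a)))"
      if "tgt ori a \<in> {i..j}"
    proof -
      have "transpose_mat (rmap V a) *\<^sub>v w (tgt ori a) \<in> carrier_vec (?d (src ori a))" using f by (intro carrier_vecI) simp
      then show ?thesis
        using *[OF disjI2[OF that]] that w(3,4) z[of "transpose_mat (rmap V a) *\<^sub>v w (tgt ori a)" "src ori a"]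
        by (auto simp: src_def tgt_def split: if_splits)
    qed
  qed (use u(2) w(2) ones in auto)
  then obtain W where W: "is_rep n ori W" "rep_iso n ori V (rep_dsum ori (thin_rep ori {i..j}) W)" by blast
  have M: "is_rep n ori (thin_rep ori {i..j} :: 'k rep)" "rep_nonzero (thin_rep ori {i..j} :: 'k rep)"
    using i j by (auto intro!: is_rep_thin_rep exI[of _ i] simp: rep_nonzero_def rdim_thin_rep)
  then have "\<not> rep_nonzero W" using assms W unfolding indecomposable_def by blast
  then have "?d t = (if t \<in> {i..j} then 1 else 0)" for t
    using rep_iso_rdim[OF W(2), of t] V(1) i j
    by (cases "t \<in> {1..n}") (auto simp: rep_nonzero_def rdim_rep_dsum rdim_thin_rep is_rep_def)
  then have "dimvec V = (\<lambda>k. if i \<le> k \<and> k \<le> j then 1 else 0)" by (auto simp: dimvec_def)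
  then show ?thesis using i j unfolding pos_roots_def by blast
qed

section \<open>The polytopes\<close>

lemma sum_telescope_from_1:
  fixes x :: "nat \<Rightarrow> real"
  shows "(\<Sum>v\<in>{1..m}. x v - x (v - 1)) = x m - x 0"
  by (induction m) auto

lemma sum_shift_from_1:
  fixes g :: "nat \<Rightarrow> real"
  shows "(\<Sum>v\<in>{1..Suc m}. g (v - 1)) = g 0 + (\<Sum>v\<in>{1..m}. g v)"
  by (induction m) auto

text \<open>\<open>max 0 y\<close> is half of \<open>\<bar>y\<bar> + y\<close>, and the differences
  telescope to 0 because \<open>x\<close> vanishes at 0 and at \<open>Suc n\<close>.\<close>

lemma sum_increments_eq_half_variation:
  fixes x :: "nat \<Rightarrow> real"
  assumes "\<And>v. v \<notin> {1..n} \<Longrightarrow> x v = 0" "\<And>v. 0 \<le> x v"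
  shows "(\<Sum>v\<in>{1..n}. max 0 (x v - x (v - 1))) = (\<Sum>v\<in>{1..Suc n}. \<bar>x v - x (v - 1)\<bar> / 2)"
proof -
  have "(\<Sum>v\<in>{1..n}. max 0 (x v - x (v - 1))) = (\<Sum>v\<in>{1..Suc n}. max 0 (x v - x (v - 1)))"
    using assms by simp
  also have "\<dots> = (\<Sum>v\<in>{1..Suc n}. \<bar>x v - x (v - 1)\<bar> / 2 + (x v - x (v - 1)) / 2)"
    by (intro sum.cong) (auto simp: max_def field_simps)
  also have "\<dots> = (\<Sum>v\<in>{1..Suc n}. \<bar>x v - x (v - 1)\<bar> / 2) + (\<Sum>v\<in>{1..Suc n}. x v - x (v - 1)) / 2"
    by (simp only: sum.distrib sum_divide_distrib)
  also have "(\<Sum>v\<in>{1..Suc n}. x v - x (v - 1)) = 0"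
    unfolding sum_telescope_from_1 using assms(1) by simp
  finally show ?thesis by simp
qed

text \<open>The common shape of both bounds: a sum of jointly convex functions of neighbouring
  coordinates, with zero padding at 0 and \<open>Suc n\<close>.\<close>

lemma convex_set_local_bound:
  fixes t :: "real \<Rightarrow> real \<Rightarrow> real"
  assumes "\<And>a b a' b' u. 0 \<le> u \<Longrightarrow> u \<le> 1 \<Longrightarrow>
    t (u * a + (1 - u) * a') (u * b + (1 - u) * b') \<le> u * t a b + (1 - u) * t a' b'"
  shows "convex_set {x. (\<forall>v. v \<notin> {1..n} \<longrightarrow> x v = 0) \<and> (\<Sum>v\<in>{1..Suc n}. t (x v) (x (v - 1))) \<le> 1}"
  unfolding convex_set_def
proof (intro ballI allI impI CollectI conjI)
  fix x y :: "nat \<Rightarrow> real" and u :: real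
  assume x: "x \<in> {x. (\<forall>v. v \<notin> {1..n} \<longrightarrow> x v = 0) \<and> (\<Sum>v\<in>{1..Suc n}. t (x v) (x (v - 1))) \<le> 1}"
    and y: "y \<in> {x. (\<forall>v. v \<notin> {1..n} \<longrightarrow> x v = 0) \<and> (\<Sum>v\<in>{1..Suc n}. t (x v) (x (v - 1))) \<le> 1}"
    and u: "0 \<le> u \<and> u \<le> 1"
  show "u * x v + (1 - u) * y v = 0" if "v \<notin> {1..n}" for v
    using x y that by simp
  have "(\<Sum>v\<in>{1..Suc n}. t (u * x v + (1 - u) * y v) (u * x (v - 1) + (1 - u) * y (v - 1)))
      \<le> (\<Sum>v\<in>{1..Suc n}. u * t (x v) (x (v - 1)) + (1 - u) * t (y v) (y (v - 1)))"
    using u by (intro sum_mono assms) auto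
  also have "\<dots> = u * (\<Sum>v\<in>{1..Suc n}. t (x v) (x (v - 1))) + (1 - u) * (\<Sum>v\<in>{1..Suc n}. t (y v) (y (v - 1)))"
    by (simp only: sum.distrib sum_distrib_left)
  also have "\<dots> \<le> u * 1 + (1 - u) * 1"
    using x y u by (intro add_mono mult_left_mono) auto
  finally show "(\<Sum>v\<in>{1..Suc n}. t (u * x v + (1 - u) * y v) (u * x (v - 1) + (1 - u) * y (v - 1))) \<le> 1"
    by simp
qed

text \<open>A root jumps by 1 at \<open>i\<close> and by -1 at \<open>Suc j\<close>, so its half
  variation is 1; negation does not change it.\<close>

lemma C_full_bound:
  assumes "x \<in> C_full n"
  shows "(\<forall>v. v \<notin> {1..n} \<longrightarrow> x v = 0) \<and> (\<Sum>v\<in>{1..Suc n}. \<bar>x v - x (v - 1)\<bar> / 2) \<le> 1"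
proof -
  let ?K = "{x :: nat \<Rightarrow> real. (\<forall>v. v \<notin> {1..n} \<longrightarrow> x v = 0) \<and> (\<Sum>v\<in>{1..Suc n}. \<bar>x v - x (v - 1)\<bar> / 2) \<le> 1}"
  have conv: "convex_set ?K"
  proof (rule convex_set_local_bound)
    fix a b a' b' u :: real assume u: "0 \<le> u" "u \<le> 1"
    have "\<bar>u * (a - b) + (1 - u) * (a' - b')\<bar> \<le> \<bar>u * (a - b)\<bar> + \<bar>(1 - u) * (a' - b')\<bar>" by (rule abs_triangle_ineq)
    also have "\<dots> = u * \<bar>a - b\<bar> + (1 - u) * \<bar>a' - b'\<bar>" using u by (simp add: abs_mult)
    also have "u * (a - b) + (1 - u) * (a' - b') = u * a + (1 - u) * a' - (u * b + (1 - u) * b')"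
      by (simp add: algebra_simps)
    finally have "\<bar>u * a + (1 - u) * a' - (u * b + (1 - u) * b')\<bar> \<le> u * \<bar>a - b\<bar> + (1 - u) * \<bar>a' - b'\<bar>" .
    then show "\<bar>u * a + (1 - u) * a' - (u * b + (1 - u) * b')\<bar> / 2 \<le> u * (\<bar>a - b\<bar> / 2) + (1 - u) * (\<bar>a' - b'\<bar> / 2)"
      unfolding times_divide_eq_right add_divide_distrib[symmetric] by (rule divide_right_mono) simp
  qed
  have root: "r \<in> ?K" if r: "r \<in> pos_roots n" for r
  proof -
    obtain i j where ij: "1 \<le> i" "i \<le> j" "j \<le> n" "r = (\<lambda>k. if i \<le> k \<and> k \<le> j then 1 else 0)"
      using r unfolding pos_roots_def by blast
    have "(\<Sum>v\<in>{1..Suc n}. \<bar>r v - r (v - 1)\<bar> / 2) =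
        (\<Sum>v\<in>{1..Suc n}. (if v = i then 1 / 2 else 0) + (if v = Suc j then 1 / 2 else 0))"
      using ij by (intro sum.cong) auto
    also have "\<dots> = 1" using ij by (simp only: sum.distrib sum.delta) simp
    finally show ?thesis using ij by auto
  qed
  have "negvec r \<in> ?K" if "r \<in> pos_roots n" for r
  proof -
    have "(\<Sum>v\<in>{1..Suc n}. \<bar>negvec r v - negvec r (v - 1)\<bar> / 2) = (\<Sum>v\<in>{1..Suc n}. \<bar>r v - r (v - 1)\<bar> / 2)"
      by (intro sum.cong) (auto simp: negvec_def abs_minus_commute)
    moreover have "\<forall>v. v \<notin> {1..n} \<longrightarrow> negvec r v = 0" using root[OF that] by (simp add: negvec_def)
    ultimately show ?thesis using root[OF that] by (simp only: mem_Collect_eq)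
  qed
  with root have "pos_roots n \<union> negvec ` pos_roots n \<subseteq> ?K" by blast
  then show ?thesis using conv_minimal[OF conv] assms unfolding C_full_def by blast
qed

text \<open>With \<open>p\<close> and \<open>q\<close> the positive and negative parts of
  \<open>x\<close>, the summand is \<open>max 0 (p v - p (v - 1)) + q (v - 1)\<close>, the weight
  needed for the summands and the negative unit vectors. Written as a maximum of linear functions
  minus a linear one it is visibly convex.\<close>

lemma C_clus_bound:
  assumes "x \<in> C_clus n"
  shows "(\<forall>v. v \<notin> {1..n} \<longrightarrow> x v = 0) \<and> (\<Sum>v\<in>{1..Suc n}. max 0 (max (x v) (x (v - 1))) - x (v - 1)) \<le> 1"
proof -
  let ?K = "{x :: nat \<Rightarrow> real. (\<forall>v. v \<notin> {1..n} \<longrightarrow> x v = 0) \<and>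
    (\<Sum>v\<in>{1..Suc n}. max 0 (max (x v) (x (v - 1))) - x (v - 1)) \<le> 1}"
  have conv: "convex_set ?K"
  proof (rule convex_set_local_bound)
    fix a b a' b' u :: real assume u: "0 \<le> u" "u \<le> 1"
    have "u * c \<le> u * max 0 (max a b)" "(1 - u) * c' \<le> (1 - u) * max 0 (max a' b')"
      if "c \<in> {0, a, b}" "c' \<in> {0, a', b'}" for c c'
      using u that by (auto intro!: mult_left_mono)
    from this[of 0 0] this[of a a'] this[of b b']
    show "max 0 (max (u * a + (1 - u) * a') (u * b + (1 - u) * b')) - (u * b + (1 - u) * b')
        \<le> u * (max 0 (max a b) - b) + (1 - u) * (max 0 (max a' b') - b')"
      by (simp add: right_diff_distrib)
  qed
  have "r \<in> ?K" if r: "r \<in> pos_roots n" for r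
  proof -
    obtain i j where ij: "1 \<le> i" "i \<le> j" "j \<le> n" "r = (\<lambda>k. if i \<le> k \<and> k \<le> j then 1 else 0)"
      using r unfolding pos_roots_def by blast
    have "(\<Sum>v\<in>{1..Suc n}. max 0 (max (r v) (r (v - 1))) - r (v - 1)) = (\<Sum>v\<in>{1..Suc n}. if v = i then 1 else 0)"
      using ij by (intro sum.cong) auto
    also have "\<dots> = 1" using ij by (subst sum.delta) auto
    finally show ?thesis using ij by auto
  qed
  moreover have "negvec (unitvec j) \<in> ?K" if "j \<in> {1..n}" for j
  proof -
    have "(\<Sum>v\<in>{1..Suc n}. max 0 (max (negvec (unitvec j) v) (negvec (unitvec j) (v - 1))) - negvec (unitvec j) (v - 1)) =
        (\<Sum>v\<in>{1..Suc n}. if v = Suc j then 1 else 0)"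
      using that by (intro sum.cong) (auto simp: negvec_def unitvec_def)
    also have "\<dots> = 1" using that by (subst sum.delta) auto
    finally show ?thesis using that by (auto simp: negvec_def unitvec_def)
  qed
  ultimately have "pos_roots n \<union> (\<lambda>j. negvec (unitvec j)) ` {1..n} \<subseteq> ?K" by blast
  then show ?thesis using conv_minimal[OF conv] assms unfolding C_clus_def by blast
qed

text \<open>0 is the midpoint of the first unit vector and its negative.\<close>

lemma zerovec_in_C:
  assumes "n \<ge> 1"
  shows "zerovec \<in> C_full n" "zerovec \<in> C_clus n"
proof -
  have u: "unitvec 1 \<in> pos_roots n"
    using assms unfolding pos_roots_def unitvec_def by (intro CollectI exI[of _ 1]) auto
  have mid: "zerovec \<in> conv S" if "unitvec 1 \<in> S" "negvec (unitvec 1) \<in> S" for S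
  proof -
    have "unitvec 1 \<in> conv S" "negvec (unitvec 1) \<in> conv S" using that conv_increasing by blast+
    then have "(\<lambda>i. 1 / 2 * unitvec 1 i + (1 - 1 / 2) * negvec (unitvec 1) i) \<in> conv S"
      using convex_set_conv[of S, unfolded convex_set_def, rule_format, of "unitvec 1" "negvec (unitvec 1)" "1 / 2"] by simp
    then show ?thesis by (simp add: zerovec_def negvec_def)
  qed
  show "zerovec \<in> C_full n" unfolding C_full_def using u by (intro mid) auto
  show "zerovec \<in> C_clus n" unfolding C_clus_def using u assms by (intro mid) auto
qed

text \<open>Makes the bound on the half variation available for \<open>C_plus\<close>, where it is
  again the total weight.\<close>

lemma C_plus_subset_C_full: "n \<ge> 1 \<Longrightarrow> C_plus n \<subseteq> C_full n"
  unfolding C_plus_def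
  using zerovec_in_C(1)[of n] conv_increasing[of "pos_roots n \<union> negvec ` pos_roots n"]
  by (intro conv_minimal) (auto simp: C_full_def convex_set_conv)

lemma C_plus_nonneg: "x \<in> C_plus n \<Longrightarrow> 0 \<le> x v"
proof -
  have "convex_set {x :: nat \<Rightarrow> real. 0 \<le> x v}" by (auto simp: convex_set_def)
  moreover have "{zerovec} \<union> pos_roots n \<subseteq> {x. 0 \<le> x v}" by (auto simp: pos_roots_def zerovec_def)
  ultimately show "x \<in> C_plus n \<Longrightarrow> 0 \<le> x v" using conv_minimal unfolding C_plus_def by blast
qed

section \<open>Equality of the polytopes\<close>

lemma tilting_list_dimvec:
  assumes "tilting_list n ori I Xs" "X \<in> set Xs"
  shows "dimvec X \<in> pos_roots n"
  using assms indecomposable_dimvec unfolding tilting_list_def by blast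

lemma decomposition_exists:
  assumes "0 \<notin> I" "\<And>v. 0 \<le> x v" "\<And>v. v \<notin> I \<Longrightarrow> x v = 0"
  shows "\<exists>T. decomposition ori I x n T"
  using deque_invariant[of I x, OF assms] by blast

text \<open>Reduces the inclusion of each \<open>C\<close> in the corresponding \<open>P\<close> to
  a bound on the total of explicitly known weights.\<close>

lemma tilting_cone:
  assumes I: "I \<subseteq> {1..n}" and x: "\<And>v. 0 \<le> x v" "\<And>v. v \<notin> I \<Longrightarrow> x v = 0"
  shows "\<exists>(Xs :: 'k::field rep list) ws. tilting_list n ori I Xs \<and>
    (\<forall>t\<in>set ws. 0 \<le> fst t \<and> snd t \<in> dimvec ` set Xs) \<and>
    (\<forall>v. x v = (\<Sum>t\<leftarrow>ws. fst t * snd t v)) \<and>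
    (\<Sum>t\<leftarrow>ws. fst t) = (\<Sum>v\<in>{1..n}. max 0 (x v - x (v - 1)))"
proof -
  obtain T where T: "decomposition ori I x n T" using decomposition_exists[of I x] I x by force
  let ?Xs = "map (\<lambda>(i, j, c). thin_rep ori {i..j} :: 'k rep) T"
  let ?w = "\<lambda>(i, j, c). (c, dimvec (thin_rep ori {i..j} :: 'k rep))"
  have T1: "1 \<le> i \<and> i \<le> j \<and> j \<le> n \<and> 0 \<le> c" if "(i, j, c) \<in> set T" for i j c
    using T that unfolding decomposition_def by blast
  have w: "fst (?w t) * snd (?w t) v = (case t of (i, j, c) \<Rightarrow> if i \<le> v \<and> v \<le> j then c else 0)" for t v
    by (auto simp: dimvec_def rdim_thin_rep split: prod.splits)
  have "x v = (\<Sum>t\<leftarrow>map ?w T. fst t * snd t v)" for v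
  proof (cases "v \<in> {1..n}")
    case True
    have "x v = (\<Sum>(i, j, c)\<leftarrow>T. if i \<le> v \<and> v \<le> j then c else 0)"
      using T True unfolding decomposition_def by blast
    then show ?thesis unfolding map_map comp_def w .
  next
    case False
    have "(\<Sum>(i, j, c)\<leftarrow>T. if i \<le> v \<and> v \<le> j then c else 0) = (\<Sum>t\<leftarrow>T. 0)"
      using T1 False by (intro arg_cong[of _ _ sum_list] map_cong) force+
    moreover have "x v = 0" using x(2)[of v] I False by blast
    ultimately show ?thesis unfolding map_map comp_def w by simp
  qed
  moreover have "(\<Sum>t\<leftarrow>map ?w T. fst t) = (\<Sum>v\<in>{1..n}. max 0 (x v - x (v - 1)))"
  proof -
    have "(\<Sum>t\<leftarrow>map ?w T. fst t) = (\<Sum>(i, j, c)\<leftarrow>T. c)"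
      unfolding map_map comp_def by (intro arg_cong[of _ _ sum_list] map_cong) auto
    then show ?thesis using T by (simp add: decomposition_def)
  qed
  moreover have "\<forall>t\<in>set (map ?w T). 0 \<le> fst t \<and> snd t \<in> dimvec ` set ?Xs"
    using T1 by force
  ultimately show ?thesis
    using tilting_list_decomposition[OF T I] by blast
qed

lemma P_plus_eq:
  assumes n: "n \<ge> 1"
  shows "P_plus TYPE('k::field) n ori = C_plus n"
proof (intro equalityI subsetI)
  fix x assume "x \<in> P_plus TYPE('k) n ori"
  then obtain Xs :: "'k rep list" where Xs: "tilting_list n ori {1..n} Xs" "x \<in> conv ({zerovec} \<union> dimvec ` set Xs)"
    unfolding P_plus_def by blast
  have "{zerovec} \<union> dimvec ` set Xs \<subseteq> C_plus n"
    unfolding C_plus_def using tilting_list_dimvec[OF Xs(1)] by (intro order.trans[OF _ conv_increasing]) auto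
  then show "x \<in> C_plus n" using conv_minimal Xs(2) convex_set_conv unfolding C_plus_def by blast
next
  fix x assume x: "x \<in> C_plus n"
  have b: "\<forall>v. v \<notin> {1..n} \<longrightarrow> x v = 0" "(\<Sum>v\<in>{1..Suc n}. \<bar>x v - x (v - 1)\<bar> / 2) \<le> 1"
    using C_full_bound x C_plus_subset_C_full[OF n] by blast+
  obtain Xs :: "'k rep list" and ws where ws: "tilting_list n ori {1..n} Xs"
    "\<forall>t\<in>set ws. 0 \<le> fst t \<and> snd t \<in> dimvec ` set Xs" "\<forall>v. x v = (\<Sum>t\<leftarrow>ws. fst t * snd t v)"
    "(\<Sum>t\<leftarrow>ws. fst t) = (\<Sum>v\<in>{1..n}. max 0 (x v - x (v - 1)))"
    using tilting_cone[of "{1..n}" n x ori] C_plus_nonneg[OF x] b(1) by blast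
  have "(\<Sum>t\<leftarrow>ws. fst t) \<le> 1"
    using ws(4) b sum_increments_eq_half_variation[of n x] C_plus_nonneg[OF x] by simp
  then have "(\<lambda>v. \<Sum>t\<leftarrow>ws. fst t * snd t v) \<in> conv ({zerovec} \<union> dimvec ` set Xs)"
    using ws(2) by (intro conv_list_combination) auto
  moreover have "x = (\<lambda>v. \<Sum>t\<leftarrow>ws. fst t * snd t v)" using ws(3) by blast
  ultimately show "x \<in> P_plus TYPE('k) n ori" unfolding P_plus_def using ws(1) by blast
qed

lemma P_clus_eq:
  assumes n: "n \<ge> 1"
  shows "P_clus TYPE('k::field) n ori = C_clus n"
proof (intro equalityI subsetI)
  fix x assume "x \<in> P_clus TYPE('k) n ori"
  then obtain Xs :: "'k rep list" and I where Xs: "tilting_list n ori I Xs"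
    "x \<in> conv ({zerovec} \<union> dimvec ` set Xs \<union> (\<lambda>j. negvec (unitvec j)) ` ({1..n} - I))"
    unfolding P_clus_def by blast
  have "dimvec ` set Xs \<union> (\<lambda>j. negvec (unitvec j)) ` ({1..n} - I) \<subseteq> C_clus n"
    unfolding C_clus_def using tilting_list_dimvec[OF Xs(1)] by (intro order.trans[OF _ conv_increasing]) auto
  then have "{zerovec} \<union> dimvec ` set Xs \<union> (\<lambda>j. negvec (unitvec j)) ` ({1..n} - I) \<subseteq> C_clus n"
    using zerovec_in_C(2)[OF n] by blast
  then show "x \<in> C_clus n" using conv_minimal Xs(2) convex_set_conv unfolding C_clus_def by blast
next
  fix x assume x: "x \<in> C_clus n"
  have b: "\<And>v. v \<notin> {1..n} \<Longrightarrow> x v = 0" "(\<Sum>v\<in>{1..Suc n}. max 0 (max (x v) (x (v - 1))) - x (v - 1)) \<le> 1"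
    using C_clus_bound[OF x] by blast+
  define I where "I = {v \<in> {1..n}. 0 < x v}"
  define p where "p v = max 0 (x v)" for v
  define q where "q v = max 0 (- x v)" for v
  have pq: "0 \<le> p v" "0 \<le> q v" "x v = p v - q v" for v by (auto simp: p_def q_def)
  have p0: "p v = 0" if "v \<notin> I" for v using that b(1)[of v] by (auto simp: p_def I_def)
  have In: "I \<subseteq> {1..n}" by (auto simp: I_def)
  obtain Xs :: "'k rep list" and ws where ws: "tilting_list n ori I Xs"
    "\<forall>t\<in>set ws. 0 \<le> fst t \<and> snd t \<in> dimvec ` set Xs" "\<forall>v. p v = (\<Sum>t\<leftarrow>ws. fst t * snd t v)"
    "(\<Sum>t\<leftarrow>ws. fst t) = (\<Sum>v\<in>{1..n}. max 0 (p v - p (v - 1)))"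
    using tilting_cone[of I n p ori, OF In pq(1) p0] by blast
  \<comment> \<open>Since \<open>p\<close> is positive on \<open>I\<close>, every vertex of
    \<open>I\<close> must lie in the support of some summand; thus the tilting module over
    \<open>I\<close> is support tilting.\<close>
  have "I \<subseteq> \<Union> (supp ` set Xs)"
  proof
    fix v assume v: "v \<in> I"
    show "v \<in> \<Union> (supp ` set Xs)"
    proof (rule ccontr)
      assume "v \<notin> \<Union> (supp ` set Xs)"
      then have "snd t v = 0" if "t \<in> set ws" for t
        using ws(2) that by (fastforce simp: supp_def dimvec_def)
      then have "(\<Sum>t\<leftarrow>ws. fst t * snd t v) = (\<Sum>t\<leftarrow>ws. 0)"
        by (intro arg_cong[of _ _ sum_list] map_cong) auto
      then have "p v = 0" using ws(3) by simp
      then show False using v by (simp add: I_def p_def)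
    qed
  qed
  moreover have "\<Union> (supp ` set Xs) \<subseteq> I" using ws(1) unfolding tilting_list_def by blast
  ultimately have I: "I = \<Union> (supp ` set Xs)" by blast
  define js where "js = sorted_list_of_set ({1..n} - I)"
  have js: "set js = {1..n} - I" "distinct js" by (simp_all add: js_def)
  let ?ts = "ws @ map (\<lambda>j. (q j, negvec (unitvec j))) js"
  have sum_js: "(\<Sum>j\<leftarrow>js. h j) = (\<Sum>j\<in>{1..n} - I. h j)" for h :: "nat \<Rightarrow> real"
    using js by (simp add: sum_list_distinct_conv_sum_set)
  have "(\<Sum>t\<leftarrow>?ts. fst t) \<le> 1"
  proof -
    have "(\<Sum>t\<leftarrow>?ts. fst t) = (\<Sum>v\<in>{1..n}. max 0 (p v - p (v - 1))) + (\<Sum>j\<in>{1..n} - I. q j)"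
      using ws(4) by (simp add: comp_def sum_js)
    \<comment> \<open>Extending the sum of \<open>q\<close> to the vertices from 0 to
      \<open>n\<close> and shifting its index lines it up with the increments, term by term as in
      \<open>C_clus_bound\<close>.\<close>
    also have "\<dots> \<le> (\<Sum>v\<in>{1..Suc n}. max 0 (p v - p (v - 1))) + (\<Sum>v\<in>{1..Suc n}. q (v - 1))"
      unfolding sum_shift_from_1 using pq(2) by (intro add_mono sum_mono2 add_increasing) auto
    also have "\<dots> = (\<Sum>v\<in>{1..Suc n}. max 0 (max (x v) (x (v - 1))) - x (v - 1))"
      unfolding sum.distrib[symmetric] by (intro sum.cong) (auto simp: p_def q_def max_def)
    finally show ?thesis using b(2) by linarith
  qed
  then have "(\<lambda>v. \<Sum>t\<leftarrow>?ts. fst t * snd t v) \<in> conv ({zerovec} \<union> dimvec ` set Xs \<union> (\<lambda>j. negvec (unitvec j)) ` ({1..n} - I))"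
    using ws(2) js pq(2) by (intro conv_list_combination) auto
  moreover have "x = (\<lambda>v. \<Sum>t\<leftarrow>?ts. fst t * snd t v)"
  proof
    fix v
    have "(\<Sum>j\<in>{1..n} - I. q j * negvec (unitvec j) v) = (\<Sum>j\<in>{1..n} - I. if j = v then - q v else 0)"
      by (intro sum.cong) (auto simp: negvec_def unitvec_def)
    also have "\<dots> = - q v"
      using b(1)[of v] by (auto simp: I_def q_def)
    finally show "x v = (\<Sum>t\<leftarrow>?ts. fst t * snd t v)"
      using ws(3) pq(3)[of v] by (simp add: comp_def sum_js)
  qed
  ultimately show "x \<in> P_clus TYPE('k) n ori"
    unfolding P_clus_def using ws(1) I by blast
qed

lemma P_full_eq:
  assumes n: "n \<ge> 1"
  shows "P_full TYPE('k::field) n ori = C_full n"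
proof (intro equalityI subsetI)
  fix x assume "x \<in> P_full TYPE('k) n ori"
  then obtain Xs Ys :: "'k rep list" and I where Xs: "tilting_list n ori I Xs" "tilting_list n ori ({1..n} - I) Ys"
    "x \<in> conv ({zerovec} \<union> dimvec ` set Xs \<union> (\<lambda>Y. negvec (dimvec Y)) ` set Ys)"
    unfolding P_full_def by blast
  have "dimvec ` set Xs \<union> (\<lambda>Y. negvec (dimvec Y)) ` set Ys \<subseteq> C_full n"
    unfolding C_full_def using tilting_list_dimvec[OF Xs(1)] tilting_list_dimvec[OF Xs(2)]
    by (intro order.trans[OF _ conv_increasing]) auto
  then have "{zerovec} \<union> dimvec ` set Xs \<union> (\<lambda>Y. negvec (dimvec Y)) ` set Ys \<subseteq> C_full n"
    using zerovec_in_C(1)[OF n] by blast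
  then show "x \<in> C_full n" using conv_minimal Xs(3) convex_set_conv unfolding C_full_def by blast
next
  fix x assume x: "x \<in> C_full n"
  have b: "\<And>v. v \<notin> {1..n} \<Longrightarrow> x v = 0" "(\<Sum>v\<in>{1..Suc n}. \<bar>x v - x (v - 1)\<bar> / 2) \<le> 1"
    using C_full_bound[OF x] by blast+
  define I where "I = {v \<in> {1..n}. 0 < x v}"
  define p where "p v = max 0 (x v)" for v
  define q where "q v = max 0 (- x v)" for v
  have pq: "0 \<le> p v" "0 \<le> q v" "x v = p v - q v" for v by (auto simp: p_def q_def)
  have p0: "p v = 0" if "v \<notin> I" for v using that b(1)[of v] by (auto simp: p_def I_def)
  have q0: "q v = 0" if "v \<notin> {1..n} - I" for v using that b(1)[of v] by (auto simp: q_def I_def)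
  have In: "I \<subseteq> {1..n}" by (auto simp: I_def)
  obtain Xs :: "'k rep list" and ws where ws: "tilting_list n ori I Xs"
    "\<forall>t\<in>set ws. 0 \<le> fst t \<and> snd t \<in> dimvec ` set Xs" "\<forall>v. p v = (\<Sum>t\<leftarrow>ws. fst t * snd t v)"
    "(\<Sum>t\<leftarrow>ws. fst t) = (\<Sum>v\<in>{1..n}. max 0 (p v - p (v - 1)))"
    using tilting_cone[of I n p ori, OF In pq(1) p0] by blast
  obtain Ys :: "'k rep list" and zs where zs: "tilting_list n ori ({1..n} - I) Ys"
    "\<forall>t\<in>set zs. 0 \<le> fst t \<and> snd t \<in> dimvec ` set Ys" "\<forall>v. q v = (\<Sum>t\<leftarrow>zs. fst t * snd t v)"
    "(\<Sum>t\<leftarrow>zs. fst t) = (\<Sum>v\<in>{1..n}. max 0 (q v - q (v - 1)))"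
    using tilting_cone[of "{1..n} - I" n q ori, OF Diff_subset pq(2) q0] by blast
  let ?ts = "ws @ map (\<lambda>t. (fst t, negvec (snd t))) zs"
  have "(\<Sum>t\<leftarrow>?ts. fst t) \<le> 1"
  proof -
    have "(\<Sum>t\<leftarrow>?ts. fst t) = (\<Sum>v\<in>{1..Suc n}. \<bar>p v - p (v - 1)\<bar> / 2) + (\<Sum>v\<in>{1..Suc n}. \<bar>q v - q (v - 1)\<bar> / 2)"
    proof -
      have "p v = 0" "q v = 0" if "v \<notin> {1..n}" for v
        using p0[of v] q0[of v] In that by blast+
      then show ?thesis
        using ws(4) zs(4) sum_increments_eq_half_variation[of n p] sum_increments_eq_half_variation[of n q] pq(1,2)
        by (simp add: comp_def)
    qed
    \<comment> \<open>Between neighbouring vertices \<open>p\<close> and \<open>- q\<close> never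
      move in opposite directions, so their absolute jumps add up to that of
      \<open>x\<close>.\<close>
    also have "\<dots> = (\<Sum>v\<in>{1..Suc n}. \<bar>x v - x (v - 1)\<bar> / 2)"
      unfolding sum.distrib[symmetric] by (intro sum.cong) (auto simp: p_def q_def max_def field_simps)
    finally show ?thesis using b(2) by linarith
  qed
  then have "(\<lambda>v. \<Sum>t\<leftarrow>?ts. fst t * snd t v) \<in> conv ({zerovec} \<union> dimvec ` set Xs \<union> (\<lambda>Y. negvec (dimvec Y)) ` set Ys)"
    using ws(2) zs(2) by (intro conv_list_combination) auto
  moreover have "x = (\<lambda>v. \<Sum>t\<leftarrow>?ts. fst t * snd t v)"
  proof
    fix v
    have "(\<Sum>t\<leftarrow>zs. fst t * negvec (snd t) v) = - q v"
      using zs(3) by (simp add: negvec_def uminus_sum_list_map comp_def)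
    then show "x v = (\<Sum>t\<leftarrow>?ts. fst t * snd t v)" using ws(3) pq(3)[of v] by (simp add: comp_def)
  qed
  ultimately show "x \<in> P_full TYPE('k) n ori" unfolding P_full_def using ws(1) zs(1) In by blast
qed

theorem theorem1p2:
  fixes n :: nat and ori :: "nat \<Rightarrow> bool"
  assumes "n \<ge> 1"
  shows "C_full n = P_full TYPE('k::field) n ori \<and>
         C_clus n = P_clus TYPE('k::field) n ori \<and>
         C_plus n = P_plus TYPE('k::field) n ori \<and>
         convex_set (P_full TYPE('k) n ori) \<and>
         convex_set (P_clus TYPE('k) n ori) \<and>
         convex_set (P_plus TYPE('k) n ori) \<and>
         (\<forall>ori'. P_full TYPE('k) n ori' = P_full TYPE('k) n ori \<and>
                 P_clus TYPE('k) n ori' = P_clus TYPE('k) n ori \<and>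
                 P_plus TYPE('k) n ori' = P_plus TYPE('k) n ori)"
  unfolding P_full_eq[OF assms] P_clus_eq[OF assms] P_plus_eq[OF assms]
  by (simp add: C_full_def C_clus_def C_plus_def convex_set_conv)

end
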